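(* Let $A\in\mathbb{R}^d$ with $|\epsilon A|<1$ and consider the high order IMEX Runge-Kutta scheme of type A which, given $(\rho^n,g^n)$ with $\langle g^n\rangle_V=0$ and $g^n=O(1)$, computes for $j=1,\dots,s$ $$\rho^{(j)}=\rho^n-\sum_{k=1}^{j}a_{jk}\frac{\Delta t}{\epsilon}\nabla_x\cdot\langle v\,g^{(k)}\rangle_V,$$ $$g^{(j)}=g^n-\frac{\Delta t}{\epsilon}\Big[\sum_{k=1}^{j-1}\tilde a_{jk}(I-\Pi)(v\cdot\nabla_x g^{(k)})+\sum_{k=1}^{j}a_{jk}vM\cdot\nabla_x\rho^{(k)}-\sum_{k=1}^{j}\frac{a_{jk}}{\epsilon}Lg^{(k)}-\sum_{k=1}^{j-1}\tilde a_{jk}\,vM\cdot A\,\rho^{(k)}\Big].$$ Then, when $\epsilon\to0$ (with $\Delta t$ fixed), the scheme degenerates into $$\rho^{(j)}=\rho^n-\Delta t\sum_{k=1}^{j}a_{jk}\nabla_x\cdot\Big(\langle v\otimes L^{-1}(vM)\rangle_V\nabla_x\rho^{(k)}\Big)+\Delta t\sum_{k=1}^{j-1}\tilde a_{jk}\nabla_x\cdot\Big(\langle v\otimes L^{-1}(vM)\rangle_V A\,\rho^{(k)}\Big)$$ for all $j\in\{1,2,\dots,s\}$.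
   Context: Kinetic setting. $\Omega\subset\mathbb{R}^d$ is the position domain with periodic boundary conditions, $V\subseteq\mathbb{R}^d$ is the velocity space with measure $d\mu(v)$, and $M=M(v)$ is a positive even equilibrium. For a function $h$ of $v$, $\langle h\rangle_V=\int_V h\,d\mu\big/\int_V M\,d\mu$; in particular $\langle M\rangle_V=1$ and $\langle vM\rangle_V=0$. $\Pi h=\langle h\rangle_V M$. $L$ is a linear operator acting only on the variable $v$, non-positive and self-adjoint in $L^2(V,M^{-1}d\mu)$, with null space $\mathrm{Span}(M)$ and range $\{f:\langle f\rangle_V=0\}$, and invariant under orthogonal transformations of $\mathbb{R}^d$; $L^{-1}$ is its pseudo-inverse, i.e. its inverse on its range. The scheme approximates the micro-macro system $\partial_t\rho+\frac1\epsilon\nabla_x\cdot\langle vg\rangle_V=0$, $\partial_t g+\frac1\epsilon(I-\Pi)(v\cdot\nabla_xg)+\frac1\epsilon vM\cdot\nabla_x\rho=\frac1{\epsilon^2}Lg+\frac1\epsilon vM\cdot A\rho$, with $\rho=\rho(t,x)$, $g=g(t,x,v)$, $\langle g\rangle_V=0$. IMEX Runge-Kutta method of type A. It is given by $s\times s$ real matrices $(\tilde a_{jk})$ (strictly lower triangular, explicit part) and $(a_{jk})$ (lower triangular and invertible, implicit part; so $a_{jj}\neq0$ for all $j$). Sums over empty ranges are zero. Asymptotic conventions. $O(\epsilon^p)$ is understood as $\epsilon\to0$ with $\Delta t$ fixed, for $\epsilon$-dependent families of functions. All functions are assumed sufficiently smooth, with $\rho^n,\rho^{(j)}$ being $O(1)$,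 and $O$-estimates are understood to be stable under $\nabla_x$, multiplication by $v$, $\Pi$, $\langle\cdot\rangle_V$, and (on functions with $\langle\cdot\rangle_V=0$) under $L^{-1}$ and $(\epsilon^2I-a_{jj}\Delta tL)^{-1}$. "The scheme degenerates into" a set of relations means that its stage values satisfy these relations up to $O(\epsilon)$ remainders. *)

theory Defs
  imports "HOL-Analysis.Analysis"
begin

section \<open>Differential operators in the position variable\<close>

definition partial :: "'d::finite \<Rightarrow> (real^'d \<Rightarrow> real) \<Rightarrow> real^'d \<Rightarrow> real" where
  "partial i f x = frechet_derivative f (at x) (axis i 1)"

text \<open>\<open>iter_partial [i1, ..., ir] f\<close> is the mixed derivative of \<open>f\<close> with respect to the
  coordinates \<open>ir, ..., i1\<close>, in this order.\<close>

definition iter_partial :: "'d::finite list \<Rightarrow> (real^'d \<Rightarrow> real) \<Rightarrow> real^'d \<Rightarrow> real" where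
  "iter_partial \<alpha> f = foldr partial \<alpha> f"

definition grad :: "(real^'d::finite \<Rightarrow> real) \<Rightarrow> real^'d \<Rightarrow> real^'d" where
  "grad f x = (\<chi> i. partial i f x)"

definition divergence :: "(real^'d::finite \<Rightarrow> real^'d) \<Rightarrow> real^'d \<Rightarrow> real" where
  "divergence F x = (\<Sum>i\<in>UNIV. partial i (\<lambda>y. F y $ i) x)"

text \<open>The position domain with periodic boundary conditions is the box with side lengths
  \<open>per $ i\<close>; functions on it are the functions on the whole space with these periods.\<close>

definition periodic :: "real^'d::finite \<Rightarrow> (real^'d \<Rightarrow> 'b) \<Rightarrow> bool" where
  "periodic per f \<longleftrightarrow> (\<forall>x i. f (x + axis i (per $ i)) = f x)"


section \<open>The velocity space and the collision operator\<close>

text \<open>The velocity space \<open>V\<close> is \<open>space \<mu>\<close>. Functions of the velocity are total functions on the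
  ambient space; only their values on \<open>space \<mu>\<close> matter.\<close>

definition vmean :: "(real^'d::finite) measure \<Rightarrow> (real^'d \<Rightarrow> real) \<Rightarrow>
    (real^'d \<Rightarrow> 'b::{banach, second_countable_topology}) \<Rightarrow> 'b" where
  "vmean \<mu> M h = (LINT v|\<mu>. h v) /\<^sub>R (LINT v|\<mu>. M v)"

text \<open>The space \<open>L\<^sup>2(V, M\<^sup>-\<^sup>1 d\<mu>)\<close>, with functions in place of classes modulo equality almost
  everywhere, its inner product, and its norm.\<close>

definition L2 :: "(real^'d::finite) measure \<Rightarrow> (real^'d \<Rightarrow> real) \<Rightarrow> (real^'d \<Rightarrow> real) set" where
  "L2 \<mu> M = {f \<in> borel_measurable \<mu>. integrable \<mu> (\<lambda>v. (f v)\<^sup>2 / M v)}"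

definition L2_inner :: "(real^'d::finite) measure \<Rightarrow> (real^'d \<Rightarrow> real) \<Rightarrow>
    (real^'d \<Rightarrow> real) \<Rightarrow> (real^'d \<Rightarrow> real) \<Rightarrow> real" where
  "L2_inner \<mu> M f h = (LINT v|\<mu>. f v * h v / M v)"

definition L2_norm :: "(real^'d::finite) measure \<Rightarrow> (real^'d \<Rightarrow> real) \<Rightarrow> (real^'d \<Rightarrow> real) \<Rightarrow> real" where
  "L2_norm \<mu> M f = sqrt (L2_inner \<mu> M f f)"

text \<open>The operator \<open>L\<close> may be unbounded and has the domain \<open>D\<close>. The moments of \<open>M\<close> are finite
  because \<open>M\<close> is one of the functions that may be multiplied by \<open>v\<close> any number of times. The
  assumption \<open>self_adjoint\<close> says that the graph of the adjoint of \<open>L\<close> is the graph of \<open>L\<close>.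
  An orthogonal transformation can act on functions on \<open>V\<close> only if it preserves \<open>V\<close> and \<open>\<mu>\<close>;
  \<open>orthogonal_invariant\<close> is required for all such transformations.\<close>

locale kinetic_setting =
  fixes per :: "real^'d::finite"
    and V :: "(real^'d) set"
    and \<mu> :: "(real^'d) measure"
    and M :: "real^'d \<Rightarrow> real"
    and D :: "(real^'d \<Rightarrow> real) set"
    and L :: "(real^'d \<Rightarrow> real) \<Rightarrow> real^'d \<Rightarrow> real"
  assumes per_pos: "\<And>i. per $ i > 0"
    and sets_\<mu>: "sets \<mu> = sets (restrict_space borel V)"
    and M_measurable: "M \<in> borel_measurable \<mu>"
    and M_pos: "\<And>v. v \<in> V \<Longrightarrow> M v > 0"
    and M_even: "\<And>v. v \<in> V \<Longrightarrow> - v \<in> V \<and> M (- v) = M v"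
    and M_moments: "\<And>m::nat. integrable \<mu> (\<lambda>v. norm v ^ m * M v)"
    and M_mean: "vmean \<mu> M M = 1"
    and vM_mean: "vmean \<mu> M (\<lambda>v. M v *\<^sub>R v) = 0"
    and domain: "D \<subseteq> L2 \<mu> M"
    and domain_subspace: "\<And>f h c1 c2. f \<in> D \<Longrightarrow> h \<in> D \<Longrightarrow> (\<lambda>v. c1 * f v + c2 * h v) \<in> D"
    and domain_dense: "\<And>f e. f \<in> L2 \<mu> M \<Longrightarrow> e > 0 \<Longrightarrow> \<exists>h\<in>D. L2_norm \<mu> M (\<lambda>v. f v - h v) < e"
    and L_in_L2: "\<And>f. f \<in> D \<Longrightarrow> L f \<in> L2 \<mu> M"
    and linear: "\<And>f h c1 c2. f \<in> D \<Longrightarrow> h \<in> D \<Longrightarrow>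
        AE v in \<mu>. L (\<lambda>v. c1 * f v + c2 * h v) v = c1 * L f v + c2 * L h v"
    and self_adjoint: "\<And>f h. f \<in> L2 \<mu> M \<Longrightarrow> h \<in> L2 \<mu> M \<Longrightarrow>
        (\<forall>u\<in>D. L2_inner \<mu> M (L u) f = L2_inner \<mu> M u h) \<longleftrightarrow> f \<in> D \<and> (AE v in \<mu>. L f v = h v)"
    and non_positive: "\<And>f. f \<in> D \<Longrightarrow> L2_inner \<mu> M (L f) f \<le> 0"
    and null_space: "\<And>f. f \<in> L2 \<mu> M \<Longrightarrow>
        f \<in> D \<and> (AE v in \<mu>. L f v = 0) \<longleftrightarrow> (\<exists>c. AE v in \<mu>. f v = c * M v)"
    and range: "\<And>h. h \<in> L2 \<mu> M \<Longrightarrow>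
        (\<exists>f\<in>D. AE v in \<mu>. L f v = h v) \<longleftrightarrow> vmean \<mu> M h = 0"
    and orthogonal_invariant: "\<And>Q f. orthogonal_transformation Q \<Longrightarrow> Q ` V = V \<Longrightarrow>
        distr \<mu> \<mu> Q = \<mu> \<Longrightarrow> f \<in> D \<Longrightarrow>
        f \<circ> Q \<in> D \<and> (AE v in \<mu>. L (f \<circ> Q) v = L f (Q v))"

text \<open>The solution of \<open>L u = h\<close> is unique (almost everywhere) only up to multiples of \<open>M\<close>. The
  condition \<open>vmean \<mu> M u = 0\<close> says that \<open>u\<close> is orthogonal to \<open>M\<close> in \<open>L\<^sup>2(V, M\<^sup>-\<^sup>1 d\<mu>)\<close>.\<close>

definition pseudo_inverse :: "(real^'d::finite) measure \<Rightarrow> (real^'d \<Rightarrow> real) \<Rightarrow>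
    (real^'d \<Rightarrow> real) set \<Rightarrow> ((real^'d \<Rightarrow> real) \<Rightarrow> real^'d \<Rightarrow> real) \<Rightarrow>
    (real^'d \<Rightarrow> real) \<Rightarrow> real^'d \<Rightarrow> real" where
  "pseudo_inverse \<mu> M D L h =
     (SOME u. u \<in> D \<and> vmean \<mu> M u = 0 \<and> (AE v in \<mu>. L u v = h v))"

text \<open>The matrix \<open>\<langle>v \<otimes> L\<^sup>-\<^sup>1(vM)\<rangle>\<close>.\<close>

definition diffusion_matrix :: "(real^'d::finite) measure \<Rightarrow> (real^'d \<Rightarrow> real) \<Rightarrow>
    (real^'d \<Rightarrow> real) set \<Rightarrow> ((real^'d \<Rightarrow> real) \<Rightarrow> real^'d \<Rightarrow> real) \<Rightarrow> real^'d^'d" where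
  "diffusion_matrix \<mu> M D L =
     (\<chi> i k. vmean \<mu> M (\<lambda>v. v $ i * pseudo_inverse \<mu> M D L (\<lambda>w. w $ k * M w) v))"


section \<open>Smooth functions and asymptotic estimates\<close>

definition smooth_macro :: "real^'d::finite \<Rightarrow> (real^'d \<Rightarrow> real) \<Rightarrow> bool" where
  "smooth_macro per f \<longleftrightarrow> periodic per f \<and> (\<forall>\<alpha> x. iter_partial \<alpha> f differentiable (at x))"

text \<open>Functions of \<open>x\<close> and \<open>v\<close> are smooth in \<open>x\<close>, and all their \<open>x\<close>-derivatives, multiplied by
  any power of \<open>v\<close>, are in \<open>L\<^sup>2(V, M\<^sup>-\<^sup>1 d\<mu>)\<close>, uniformly in \<open>x\<close>.\<close>

definition weighted_deriv :: "nat \<Rightarrow> 'd::finite list \<Rightarrow> (real^'d \<Rightarrow> real^'d \<Rightarrow> real) \<Rightarrow>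
    real^'d \<Rightarrow> real^'d \<Rightarrow> real" where
  "weighted_deriv m \<alpha> f x v = norm v ^ m * iter_partial \<alpha> (\<lambda>y. f y v) x"

definition smooth_kinetic :: "real^'d::finite \<Rightarrow> (real^'d) measure \<Rightarrow> (real^'d \<Rightarrow> real) \<Rightarrow>
    (real^'d \<Rightarrow> real^'d \<Rightarrow> real) \<Rightarrow> bool" where
  "smooth_kinetic per \<mu> M f \<longleftrightarrow>
     (\<forall>v\<in>space \<mu>. smooth_macro per (\<lambda>x. f x v)) \<and>
     (\<forall>m \<alpha> x. weighted_deriv m \<alpha> f x \<in> L2 \<mu> M) \<and>
     (\<forall>m \<alpha>. \<exists>C. \<forall>x. L2_norm \<mu> M (weighted_deriv m \<alpha> f x) \<le> C)"

text \<open>\<open>O(\<epsilon>\<^sup>p)\<close> as \<open>\<epsilon> \<rightarrow> 0\<close>, for families of smooth functions indexed by \<open>\<epsilon> > 0\<close>. The estimates are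
  uniform in \<open>x\<close> and hold for all \<open>x\<close>-derivatives and, if there is a velocity variable, for all
  powers of \<open>v\<close>. This makes them stable under \<open>x\<close>-derivatives and multiplication by \<open>v\<close>.\<close>

definition bigo_macro :: "real^'d::finite \<Rightarrow> nat \<Rightarrow> (real \<Rightarrow> real^'d \<Rightarrow> real) \<Rightarrow> bool" where
  "bigo_macro per p f \<longleftrightarrow>
     (\<forall>\<^sub>F \<epsilon> in at_right 0. smooth_macro per (f \<epsilon>)) \<and>
     (\<forall>\<alpha>. \<exists>C. \<forall>\<^sub>F \<epsilon> in at_right 0. \<forall>x. \<bar>iter_partial \<alpha> (f \<epsilon>) x\<bar> \<le> C * \<epsilon> ^ p)"

definition bigo_kinetic :: "real^'d::finite \<Rightarrow> (real^'d) measure \<Rightarrow> (real^'d \<Rightarrow> real) \<Rightarrow>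
    nat \<Rightarrow> (real \<Rightarrow> real^'d \<Rightarrow> real^'d \<Rightarrow> real) \<Rightarrow> bool" where
  "bigo_kinetic per \<mu> M p f \<longleftrightarrow>
     (\<forall>\<^sub>F \<epsilon> in at_right 0. smooth_kinetic per \<mu> M (f \<epsilon>)) \<and>
     (\<forall>m \<alpha>. \<exists>C. \<forall>\<^sub>F \<epsilon> in at_right 0. \<forall>x.
        L2_norm \<mu> M (weighted_deriv m \<alpha> (f \<epsilon>) x) \<le> C * \<epsilon> ^ p)"

text \<open>Stability of smoothness and of the estimates under velocity averages. Stability under
  \<open>\<Pi>\<close> follows from it, since \<open>M\<close> has finite moments.\<close>

definition mean_stable :: "real^'d::finite \<Rightarrow> (real^'d) measure \<Rightarrow> (real^'d \<Rightarrow> real) \<Rightarrow> bool" where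
  "mean_stable per \<mu> M \<longleftrightarrow>
     (\<forall>f. smooth_kinetic per \<mu> M f \<longrightarrow> smooth_macro per (\<lambda>x. vmean \<mu> M (f x))) \<and>
     (\<forall>p f. bigo_kinetic per \<mu> M p f \<longrightarrow> bigo_macro per p (\<lambda>\<epsilon> x. vmean \<mu> M (f \<epsilon> x)))"

text \<open>Stability under \<open>L\<^sup>-\<^sup>1\<close> on functions with zero velocity average. The values of \<open>L\<^sup>-\<^sup>1\<close> are
  determined almost everywhere in \<open>v\<close> only, so that smoothness in \<open>x\<close> is a property of a suitable
  representative.\<close>

definition inverse_stable :: "real^'d::finite \<Rightarrow> (real^'d) measure \<Rightarrow> (real^'d \<Rightarrow> real) \<Rightarrow>
    (real^'d \<Rightarrow> real) set \<Rightarrow> ((real^'d \<Rightarrow> real) \<Rightarrow> real^'d \<Rightarrow> real) \<Rightarrow> bool" where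
  "inverse_stable per \<mu> M D L \<longleftrightarrow>
     (\<forall>f. smooth_kinetic per \<mu> M f \<and> (\<forall>x. vmean \<mu> M (f x) = 0) \<longrightarrow>
        (\<exists>u. smooth_kinetic per \<mu> M u \<and>
             (\<forall>x. AE v in \<mu>. u x v = pseudo_inverse \<mu> M D L (f x) v))) \<and>
     (\<forall>p f u. bigo_kinetic per \<mu> M p f \<and>
        (\<forall>\<^sub>F \<epsilon> in at_right 0. smooth_kinetic per \<mu> M (u \<epsilon>) \<and> (\<forall>x. vmean \<mu> M (f \<epsilon> x) = 0 \<and>
           (AE v in \<mu>. u \<epsilon> x v = pseudo_inverse \<mu> M D L (f \<epsilon> x) v))) \<longrightarrow>
        bigo_kinetic per \<mu> M p u)"

text \<open>Stability under \<open>(\<epsilon>\<^sup>2 I - c L)\<^sup>-\<^sup>1\<close> on functions with zero velocity average.\<close>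

definition resolvent_stable :: "real^'d::finite \<Rightarrow> (real^'d) measure \<Rightarrow> (real^'d \<Rightarrow> real) \<Rightarrow>
    (real^'d \<Rightarrow> real) set \<Rightarrow> ((real^'d \<Rightarrow> real) \<Rightarrow> real^'d \<Rightarrow> real) \<Rightarrow> real \<Rightarrow> bool" where
  "resolvent_stable per \<mu> M D L c \<longleftrightarrow>
     (\<forall>p f u. bigo_kinetic per \<mu> M p f \<and>
        (\<forall>\<^sub>F \<epsilon> in at_right 0. smooth_kinetic per \<mu> M (u \<epsilon>) \<and>
           (\<forall>x. vmean \<mu> M (f \<epsilon> x) = 0 \<and> vmean \<mu> M (u \<epsilon> x) = 0 \<and> u \<epsilon> x \<in> D \<and>
                (AE v in \<mu>. \<epsilon>\<^sup>2 * u \<epsilon> x v - c * L (u \<epsilon> x) v = f \<epsilon> x v))) \<longrightarrow>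
        bigo_kinetic per \<mu> M p u)"


section \<open>Runge-Kutta methods\<close>

definition type_A_tableau :: "nat \<Rightarrow> (nat \<Rightarrow> nat \<Rightarrow> real) \<Rightarrow> (nat \<Rightarrow> nat \<Rightarrow> real) \<Rightarrow> bool" where
  "type_A_tableau s a_ex a \<longleftrightarrow>
     (\<forall>j\<in>{1..s}. \<forall>k\<in>{1..s}. j \<le> k \<longrightarrow> a_ex j k = 0) \<and>
     (\<forall>j\<in>{1..s}. \<forall>k\<in>{1..s}. j < k \<longrightarrow> a j k = 0) \<and>
     (\<exists>b. \<forall>j\<in>{1..s}. \<forall>k\<in>{1..s}.
        (\<Sum>l=1..s. a j l * b l k) = (if j = k then 1 else 0) \<and>
        (\<Sum>l=1..s. b j l * a l k) = (if j = k then 1 else 0))"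

end

theory Submission
  imports Defs
begin

text \<open>Multiplied by \<open>\<epsilon>\<^sup>2\<close>, the \<open>j\<close>-th kinetic stage is a resolvent equation for \<open>g\<^sub>j\<close> whose
  right-hand side is \<open>O(\<epsilon>)\<close> once \<open>g\<^sub>k\<close> and \<open>L g\<^sub>k\<close> are known to be \<open>O(\<epsilon>)\<close> for \<open>k < j\<close>. Hence, by
  induction, all stages are \<open>O(\<epsilon>)\<close>. Read again with this knowledge, the same equation says that the
  combination \<open>\<Sum>\<^sub>k a\<^sub>j\<^sub>k L g\<^sub>k\<close> is \<open>\<epsilon> vM \<bullet> W\<^sub>j + O(\<epsilon>\<^sup>2)\<close>, where \<open>W\<^sub>j\<close> combines the \<open>\<nabla>\<rho>\<^sub>k\<close> with the implicit
  coefficients and the \<open>- A \<rho>\<^sub>k\<close> with the explicit ones. Applying \<open>L\<^sup>-\<^sup>1\<close> gives \<open>\<Sum>\<^sub>k a\<^sub>j\<^sub>k g\<^sub>k\<close> up to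
  \<open>O(\<epsilon>\<^sup>2)\<close>, and the macroscopic stage contains exactly this combination, divided by \<open>\<epsilon>\<close>.\<close>

section \<open>Derivatives and estimates in the position variable\<close>

text \<open>\<open>L\<close> may be unbounded, so an estimate of a stage says nothing about its
  image under \<open>L\<close>; that estimate is read off from the stage equation itself, which
  works because the diagonal entries of \<open>a\<close> are nonzero. The stability hypotheses for
  the inverse and the resolvent concern functions with zero velocity average. The stages are not
  assumed to have zero average but inherit it from their equation, all of whose other terms have it.
  Finally, \<open>pseudo_inverse\<close> selects a representative separately for each x, so its
  values cannot be differentiated in x. The combination of the stages minus its leading term is
  therefore taken as an explicit smooth function, and it is identified with a pseudo-inverse only
  almost everywhere in v. The leading term is explicit because the source is a finite sum of
  products of \<open>v $ i * M v\<close> with functions of x: one x-independent corrector for each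
  coordinate suffices, and the averages of v times these correctors are the entries of the diffusion
  matrix.\<close>

lemma partial_eqI: "(f has_derivative f') (at x) \<Longrightarrow> partial i f x = f' (axis i 1)"
  unfolding partial_def by (metis frechet_derivative_at)

lemma partial_lincomb:
  assumes "f differentiable (at x)" "h differentiable (at x)"
  shows "partial i (\<lambda>y. c1 * f y + c2 * h y) x = c1 * partial i f x + c2 * partial i h x"
proof -
  have "((\<lambda>y. c1 * f y + c2 * h y) has_derivative
      (\<lambda>t. c1 * frechet_derivative f (at x) t + c2 * frechet_derivative h (at x) t)) (at x)"
    using assms unfolding frechet_derivative_works
    by (intro has_derivative_add has_derivative_mult_right)
  from partial_eqI[OF this] show ?thesis
    by (simp add: partial_def)
qed

lemma partial_zero [simp]: "partial i (\<lambda>x. 0) = (\<lambda>x. 0)"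
  by (rule ext, subst partial_eqI[OF has_derivative_const]) simp

lemma partial_sum:
  assumes "finite S" "\<And>k. k \<in> S \<Longrightarrow> f k differentiable (at x)"
  shows "partial i (\<lambda>y. \<Sum>k\<in>S. c k * f k y) x = (\<Sum>k\<in>S. c k * partial i (f k) x)"
proof -
  have "((\<lambda>y. \<Sum>k\<in>S. c k * f k y) has_derivative
      (\<lambda>t. \<Sum>k\<in>S. c k * frechet_derivative (f k) (at x) t)) (at x)"
    using assms(2) unfolding frechet_derivative_works
    by (intro has_derivative_sum has_derivative_mult_right)
  from partial_eqI[OF this] show ?thesis
    by (simp add: partial_def)
qed

lemma partial_shift:
  assumes "f differentiable (at (x + c))"
  shows "partial i (\<lambda>y. f (y + c)) x = partial i f (x + c)"
proof -
  have "((\<lambda>y. f (y + c)) has_derivative (\<lambda>t. frechet_derivative f (at (x + c)) t)) (at x)"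
    using has_derivative_compose[of "\<lambda>y. y + c" "\<lambda>t. t" x UNIV f "frechet_derivative f (at (x + c))"]
      assms has_derivative_add_const[OF has_derivative_ident, of c "at x"]
    unfolding frechet_derivative_works by simp
  from partial_eqI[OF this] show ?thesis
    by (simp add: partial_def)
qed

lemma iter_partial_Nil [simp]: "iter_partial [] f = f"
  and iter_partial_Cons [simp]: "iter_partial (i # \<alpha>) f = partial i (iter_partial \<alpha> f)"
  by (simp_all add: iter_partial_def)

text \<open>The last entry of the list acts first, so a derivative taken inside becomes an entry at
  the end. Bounds that hold for all lists thus pass from \<open>f\<close> to its partial
  derivatives.\<close>

lemma iter_partial_partial: "iter_partial \<alpha> (partial i f) = iter_partial (\<alpha> @ [i]) f"
  by (simp add: iter_partial_def)

lemma iter_partial_zero [simp]: "iter_partial \<alpha> (\<lambda>x. 0) = (\<lambda>x. 0)"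
  by (induction \<alpha>) simp_all

lemma iter_partial_lincomb:
  assumes "\<And>\<alpha> x. iter_partial \<alpha> f differentiable (at x)"
    and "\<And>\<alpha> x. iter_partial \<alpha> h differentiable (at x)"
  shows "iter_partial \<alpha> (\<lambda>y. c1 * f y + c2 * h y) =
    (\<lambda>y. c1 * iter_partial \<alpha> f y + c2 * iter_partial \<alpha> h y)"
proof (induction \<alpha>)
  case (Cons i \<alpha>)
  show ?case
    by (rule ext) (simp add: Cons.IH partial_lincomb[OF assms])
qed simp

lemma smooth_macroD:
  "smooth_macro per f \<Longrightarrow> iter_partial \<alpha> f differentiable (at x)"
  "smooth_macro per f \<Longrightarrow> f differentiable (at x)"
  "smooth_macro per f \<Longrightarrow> periodic per f"
  unfolding smooth_macro_def using iter_partial_Nil by metis+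

lemma smooth_macro_iter_lincomb:
  assumes "smooth_macro per f" "smooth_macro per h"
  shows "iter_partial \<alpha> (\<lambda>y. c1 * f y + c2 * h y) =
    (\<lambda>y. c1 * iter_partial \<alpha> f y + c2 * iter_partial \<alpha> h y)"
  by (rule iter_partial_lincomb) (use assms in \<open>auto dest: smooth_macroD\<close>)

lemma smooth_macro_lincomb:
  assumes "smooth_macro per f" "smooth_macro per h"
  shows "smooth_macro per (\<lambda>y. c1 * f y + c2 * h y)"
  using assms unfolding smooth_macro_def
  by (auto simp: smooth_macro_iter_lincomb[OF assms] periodic_def intro!: derivative_intros)

lemma smooth_macro_zero [simp]: "smooth_macro per (\<lambda>x. 0)"
  by (simp add: smooth_macro_def periodic_def)

lemma smooth_macro_cmult: "smooth_macro per f \<Longrightarrow> smooth_macro per (\<lambda>y. c * f y)"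
  using smooth_macro_lincomb[of per f f c 0] by simp

lemma smooth_macro_iter_cmult:
  "smooth_macro per f \<Longrightarrow> iter_partial \<alpha> (\<lambda>y. c * f y) = (\<lambda>y. c * iter_partial \<alpha> f y)"
  using smooth_macro_iter_lincomb[of per f f \<alpha> c 0] by simp

text \<open>Differentiation commutes with the translation by a period, and this translation leaves
  \<open>f\<close> fixed.\<close>

lemma periodic_partial:
  assumes "periodic per f" "\<And>x. f differentiable (at x)"
  shows "periodic per (partial i f)"
  unfolding periodic_def
proof safe
  fix x k
  have "(\<lambda>y. f (y + axis k (per $ k))) = f"
    using assms(1) by (simp add: periodic_def)
  with partial_shift[OF assms(2), of i "axis k (per $ k)" x]
  show "partial i f (x + axis k (per $ k)) = partial i f x" by simp
qed

lemma smooth_macro_partial: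
  assumes "smooth_macro per f" shows "smooth_macro per (partial i f)"
  using assms periodic_partial[of per f i] smooth_macroD(2)[OF assms]
  by (simp add: smooth_macro_def iter_partial_partial)

lemma smooth_macro_iter_partial: "smooth_macro per f \<Longrightarrow> smooth_macro per (iter_partial \<alpha> f)"
  by (induction \<alpha>) (simp_all add: smooth_macro_partial)

section \<open>Bounds for smooth periodic functions\<close>

lemma periodic_int_shift:
  fixes f :: "real^'d::finite \<Rightarrow> 'b"
  assumes "periodic per f"
  shows "f (x + axis i (of_int n * per $ i)) = f x"
proof -
  have ax: "axis i (p + q) = axis i p + (axis i q :: real^'d)" for p q :: real
    by (simp add: vec_eq_iff axis_def)
  have nat: "f (x + axis i (real n * per $ i)) = f x" for n x
  proof (induction n)
    case (Suc n)
    have "f (x + axis i (real (Suc n) * per $ i)) = f ((x + axis i (real n * per $ i)) + axis i (per $ i))"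
      by (simp add: ax algebra_simps)
    also have "\<dots> = f x"
      using assms Suc by (simp add: periodic_def)
    finally show ?case .
  qed (simp add: axis_def vec_eq_iff flip: zero_vec_def)
  show ?thesis
  proof (cases "n \<ge> 0")
    case True
    then show ?thesis using nat[of x "nat n"] by simp
  next
    case False
    \<comment> \<open>For negative \<open>n\<close> the non-negative case is applied at the
      translated point: adding \<open>- n\<close> periods leads back to \<open>x\<close>.\<close>
    have "f (x + axis i (of_int n * per $ i)) =
        f ((x + axis i (of_int n * per $ i)) + axis i (real (nat (- n)) * per $ i))"
      by (rule nat[symmetric])
    also have "\<dots> = f (x + axis i (of_int n * per $ i + real (nat (- n)) * per $ i))"
      by (simp add: ax add.assoc)
    also have "of_int n * per $ i + real (nat (- n)) * per $ i = 0"
      using False by simp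
    finally show ?thesis by (simp add: axis_def flip: zero_vec_def)
  qed
qed

text \<open>Integer multiples of the periods move every point into the compact box
  \<open>cbox 0 per\<close>, where continuity gives a bound.\<close>

lemma periodic_continuous_bounded:
  fixes f :: "real^'d::finite \<Rightarrow> real"
  assumes "periodic per f" "continuous_on UNIV f" and pos: "\<And>i. per $ i > 0"
  shows "\<exists>C. \<forall>x. \<bar>f x\<bar> \<le> C"
proof -
  have "compact (f ` cbox 0 per)"
    using assms(2) by (intro compact_continuous_image compact_cbox) (auto intro: continuous_on_subset)
  then obtain C where C: "\<And>y. y \<in> cbox 0 per \<Longrightarrow> \<bar>f y\<bar> \<le> C"
    using compact_imp_bounded bounded_iff by (metis imageI real_norm_def)
  have "\<bar>f x\<bar> \<le> C" for x
  proof -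
    \<comment> \<open>Adding \<open>n i\<close> periods takes the coordinate \<open>i\<close> into
      the interval from 0 to \<open>per $ i\<close>. Periodicity moves one axis at a time, so the
      total shift is assembled by induction over the set \<open>S\<close> of axes already
      treated.\<close>
    define n where "n i = - \<lfloor>x $ i / per $ i\<rfloor>" for i
    define sh where "sh S = (\<Sum>i\<in>S. axis i (of_int (n i) * per $ i))" for S
    have "f (x + sh S) = f x" if "finite S" for S
      using that
    proof (induction S)
      case (insert i S)
      have "f (x + sh (insert i S)) = f ((x + sh S) + axis i (of_int (n i) * per $ i))"
        using insert by (simp add: sh_def algebra_simps)
      then show ?case
        using insert periodic_int_shift[OF assms(1)] by simp
    qed (simp add: sh_def)
    then have "f (x + sh UNIV) = f x" by simp
    moreover have "x + sh UNIV \<in> cbox 0 per"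
    proof -
      have *: "(x + sh UNIV) $ i = x $ i - of_int \<lfloor>x $ i / per $ i\<rfloor> * per $ i" for i
        by (simp add: sh_def n_def axis_def if_distrib cong: if_cong)
      have "of_int \<lfloor>x $ i / per $ i\<rfloor> * per $ i \<le> x $ i"
        "x $ i \<le> (of_int \<lfloor>x $ i / per $ i\<rfloor> + 1) * per $ i" for i
        using pos[of i] pos_le_divide_eq[OF pos, THEN iffD1, OF of_int_floor_le]
        by (simp_all flip: pos_divide_le_eq)
      then show ?thesis
        by (simp add: mem_box_cart * algebra_simps del: vector_add_component)
    qed
    ultimately show ?thesis using C by metis
  qed
  then show ?thesis by blast
qed

text \<open>Supplies the bounds uniform in x that \<open>smooth_kinetic\<close> asks of products
  \<open>\<psi> v * h x\<close>.\<close>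

lemma smooth_macro_bounded:
  assumes "smooth_macro per f" "\<And>i. per $ i > 0"
  shows "\<exists>C. \<forall>x. \<bar>iter_partial \<alpha> f x\<bar> \<le> C"
  using smooth_macroD[OF smooth_macro_iter_partial[OF assms(1)]] assms(2)
  by (intro periodic_continuous_bounded)
    (auto simp: continuous_on_eq_continuous_at differentiable_imp_continuous_within)

section \<open>Order estimates for families of functions of position\<close>

lemma bigo_macroD:
  assumes "bigo_macro per p f"
  shows "\<forall>\<^sub>F \<epsilon> in at_right 0. smooth_macro per (f \<epsilon>)"
  using assms by (simp add: bigo_macro_def)

lemma eventually_interval: "e > 0 \<Longrightarrow> \<forall>\<^sub>F \<epsilon> in at_right 0. \<epsilon> \<in> {0<..<e::real}"
  by (auto intro: eventually_at_rightI)

lemma eventually_pos: "\<forall>\<^sub>F \<epsilon> in at_right 0. (\<epsilon>::real) > 0"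
  by (simp add: eventually_at_right_less)

lemma bigo_macro_boundE:
  assumes "bigo_macro per p f"
  obtains C where "\<forall>\<^sub>F \<epsilon> in at_right 0. \<forall>x. \<bar>iter_partial \<alpha> (f \<epsilon>) x\<bar> \<le> C * \<epsilon> ^ p"
  using assms by (auto simp: bigo_macro_def)

text \<open>The stage relations hold only for \<epsilon> below \<open>\<epsilon>0\<close>, so
  identities derived from them can be used only in this eventual form.\<close>

lemma bigo_macro_cong:
  assumes "\<forall>\<^sub>F \<epsilon> in at_right 0. f \<epsilon> = h \<epsilon>" "bigo_macro per p f"
  shows "bigo_macro per p h"
  unfolding bigo_macro_def
proof safe
  show "\<forall>\<^sub>F \<epsilon> in at_right 0. smooth_macro per (h \<epsilon>)"
    using assms(1) bigo_macroD[OF assms(2)] by eventually_elim simp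
  fix \<alpha>
  obtain C where "\<forall>\<^sub>F \<epsilon> in at_right 0. \<forall>x. \<bar>iter_partial \<alpha> (f \<epsilon>) x\<bar> \<le> C * \<epsilon> ^ p"
    using assms(2) by (rule bigo_macro_boundE)
  with assms(1) have "\<forall>\<^sub>F \<epsilon> in at_right 0. \<forall>x. \<bar>iter_partial \<alpha> (h \<epsilon>) x\<bar> \<le> C * \<epsilon> ^ p"
    by eventually_elim simp
  then show "\<exists>C. \<forall>\<^sub>F \<epsilon> in at_right 0. \<forall>x. \<bar>iter_partial \<alpha> (h \<epsilon>) x\<bar> \<le> C * \<epsilon> ^ p" ..
qed

lemma bigo_macro_lincomb:
  assumes "bigo_macro per p f" "bigo_macro per p h"
  shows "bigo_macro per p (\<lambda>\<epsilon> x. c1 * f \<epsilon> x + c2 * h \<epsilon> x)"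
  unfolding bigo_macro_def
proof safe
  show "\<forall>\<^sub>F \<epsilon> in at_right 0. smooth_macro per (\<lambda>x. c1 * f \<epsilon> x + c2 * h \<epsilon> x)"
    using bigo_macroD[OF assms(1)] bigo_macroD[OF assms(2)]
    by eventually_elim (rule smooth_macro_lincomb)
  fix \<alpha>
  obtain C1 where C1: "\<forall>\<^sub>F \<epsilon> in at_right 0. \<forall>x. \<bar>iter_partial \<alpha> (f \<epsilon>) x\<bar> \<le> C1 * \<epsilon> ^ p"
    using assms(1) by (rule bigo_macro_boundE)
  obtain C2 where "\<forall>\<^sub>F \<epsilon> in at_right 0. \<forall>x. \<bar>iter_partial \<alpha> (h \<epsilon>) x\<bar> \<le> C2 * \<epsilon> ^ p"
    using assms(2) by (rule bigo_macro_boundE)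
  with C1 have "\<forall>\<^sub>F \<epsilon> in at_right 0. \<forall>x. \<bar>iter_partial \<alpha> (\<lambda>x. c1 * f \<epsilon> x + c2 * h \<epsilon> x) x\<bar>
      \<le> (\<bar>c1\<bar> * C1 + \<bar>c2\<bar> * C2) * \<epsilon> ^ p"
    using bigo_macroD[OF assms(1)] bigo_macroD[OF assms(2)]
  proof eventually_elim
    case (elim \<epsilon>)
    show ?case
    proof
      fix x
      have "\<bar>c1 * iter_partial \<alpha> (f \<epsilon>) x + c2 * iter_partial \<alpha> (h \<epsilon>) x\<bar>
          \<le> \<bar>c1\<bar> * \<bar>iter_partial \<alpha> (f \<epsilon>) x\<bar> + \<bar>c2\<bar> * \<bar>iter_partial \<alpha> (h \<epsilon>) x\<bar>"
        by (metis abs_mult abs_triangle_ineq)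
      also have "\<dots> \<le> \<bar>c1\<bar> * (C1 * \<epsilon> ^ p) + \<bar>c2\<bar> * (C2 * \<epsilon> ^ p)"
        using elim by (intro add_mono mult_left_mono) auto
      finally show "\<bar>iter_partial \<alpha> (\<lambda>x. c1 * f \<epsilon> x + c2 * h \<epsilon> x) x\<bar>
          \<le> (\<bar>c1\<bar> * C1 + \<bar>c2\<bar> * C2) * \<epsilon> ^ p"
        by (simp add: smooth_macro_iter_lincomb[OF elim(3,4)] algebra_simps)
    qed
  qed
  then show "\<exists>C. \<forall>\<^sub>F \<epsilon> in at_right 0. \<forall>x.
      \<bar>iter_partial \<alpha> (\<lambda>x. c1 * f \<epsilon> x + c2 * h \<epsilon> x) x\<bar> \<le> C * \<epsilon> ^ p" ..
qed

lemma bigo_macro_zero [simp]: "bigo_macro per p (\<lambda>\<epsilon> x. 0)"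
  unfolding bigo_macro_def by (auto intro!: exI[of _ 0])

lemma bigo_macro_cmult:
  "bigo_macro per p f \<Longrightarrow> bigo_macro per p (\<lambda>\<epsilon> x. c * f \<epsilon> x)"
  using bigo_macro_lincomb[of per p f f c 0] by simp

lemma bigo_macro_sum:
  assumes "finite S" "\<And>k. k \<in> S \<Longrightarrow> bigo_macro per p (f k)"
  shows "bigo_macro per p (\<lambda>\<epsilon> x. \<Sum>k\<in>S. f k \<epsilon> x)"
  using assms
proof (induction S)
  case (insert k S)
  then show ?case using bigo_macro_lincomb[of per p "f k" "\<lambda>\<epsilon> x. \<Sum>k\<in>S. f k \<epsilon> x" 1 1] by simp
qed simp

lemma bigo_macro_partial:
  assumes "bigo_macro per p f"
  shows "bigo_macro per p (\<lambda>\<epsilon>. partial i (f \<epsilon>))"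
  using assms unfolding bigo_macro_def iter_partial_partial
  by (auto elim: eventually_mono intro: smooth_macro_partial)

text \<open>The macroscopic stage carries the factor 1 / \<epsilon>, which costs one order.\<close>

lemma bigo_macro_div:
  assumes "bigo_macro per (Suc p) f"
  shows "bigo_macro per p (\<lambda>\<epsilon> x. f \<epsilon> x / \<epsilon>)"
  unfolding bigo_macro_def
proof safe
  show "\<forall>\<^sub>F \<epsilon> in at_right 0. smooth_macro per (\<lambda>x. f \<epsilon> x / \<epsilon>)"
    using bigo_macroD[OF assms]
    by eventually_elim (use smooth_macro_cmult[of per _ "1 / _"] in simp)
  fix \<alpha>
  obtain C where "\<forall>\<^sub>F \<epsilon> in at_right 0. \<forall>x. \<bar>iter_partial \<alpha> (f \<epsilon>) x\<bar> \<le> C * \<epsilon> ^ Suc p"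
    using assms by (rule bigo_macro_boundE)
  then have "\<forall>\<^sub>F \<epsilon> in at_right 0. \<forall>x. \<bar>iter_partial \<alpha> (\<lambda>x. f \<epsilon> x / \<epsilon>) x\<bar> \<le> C * \<epsilon> ^ p"
    using bigo_macroD[OF assms] eventually_pos
  proof eventually_elim
    case (elim \<epsilon>)
    have "iter_partial \<alpha> (\<lambda>x. f \<epsilon> x / \<epsilon>) = (\<lambda>x. iter_partial \<alpha> (f \<epsilon>) x / \<epsilon>)"
      using smooth_macro_iter_cmult[OF elim(2), of \<alpha> "1 / \<epsilon>"] by simp
    then show ?case using elim by (simp add: field_simps)
  qed
  then show "\<exists>C. \<forall>\<^sub>F \<epsilon> in at_right 0. \<forall>x. \<bar>iter_partial \<alpha> (\<lambda>x. f \<epsilon> x / \<epsilon>) x\<bar> \<le> C * \<epsilon> ^ p" ..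
qed

section \<open>Weighted square-integrable functions of the velocity\<close>

text \<open>The x-independent counterpart of \<open>smooth_kinetic\<close>: the velocity factors
  \<open>\<psi>\<close> for which \<open>\<psi> v * h x\<close> is a smooth kinetic function
  whenever \<open>h\<close> is smooth and periodic.\<close>

definition rapid :: "(real^'d::finite) measure \<Rightarrow> (real^'d \<Rightarrow> real) \<Rightarrow> (real^'d \<Rightarrow> real) \<Rightarrow> bool" where
  "rapid \<mu> M \<psi> \<longleftrightarrow> (\<forall>m. (\<lambda>v. norm v ^ m * \<psi> v) \<in> L2 \<mu> M)"

lemma smooth_kineticD:
  assumes "smooth_kinetic per \<mu> M f"
  shows "v \<in> space \<mu> \<Longrightarrow> smooth_macro per (\<lambda>x. f x v)"
    and "weighted_deriv m \<alpha> f x \<in> L2 \<mu> M"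
  using assms by (auto simp: smooth_kinetic_def)

lemma smooth_kinetic_boundE:
  assumes "smooth_kinetic per \<mu> M f"
  obtains C where "\<And>x. L2_norm \<mu> M (weighted_deriv m \<alpha> f x) \<le> C"
  using assms unfolding smooth_kinetic_def by meson

lemma smooth_kinetic_rapid: "smooth_kinetic per \<mu> M f \<Longrightarrow> rapid \<mu> M (f x)"
  using smooth_kineticD(2)[of per \<mu> M f _ "[]" x] by (simp add: rapid_def weighted_deriv_def[abs_def])

lemma bigo_kineticD:
  "bigo_kinetic per \<mu> M p f \<Longrightarrow> \<forall>\<^sub>F \<epsilon> in at_right 0. smooth_kinetic per \<mu> M (f \<epsilon>)"
  by (simp add: bigo_kinetic_def)

lemma bigo_kinetic_boundE:
  assumes "bigo_kinetic per \<mu> M p f"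
  obtains C where "\<forall>\<^sub>F \<epsilon> in at_right 0. \<forall>x. L2_norm \<mu> M (weighted_deriv m \<alpha> (f \<epsilon>) x) \<le> C * \<epsilon> ^ p"
  using assms by (auto simp: bigo_kinetic_def)

lemma bigo_kinetic_weaken:
  assumes "bigo_kinetic per \<mu> M (Suc p) f"
  shows "bigo_kinetic per \<mu> M p f"
  unfolding bigo_kinetic_def
proof safe
  show "\<forall>\<^sub>F \<epsilon> in at_right 0. smooth_kinetic per \<mu> M (f \<epsilon>)"
    using assms by (rule bigo_kineticD)
  fix m and \<alpha> :: "'a list"
  obtain C where "\<forall>\<^sub>F \<epsilon> in at_right 0. \<forall>x.
      L2_norm \<mu> M (weighted_deriv m \<alpha> (f \<epsilon>) x) \<le> C * \<epsilon> ^ Suc p"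
    using assms by (rule bigo_kinetic_boundE)
  then have "\<forall>\<^sub>F \<epsilon> in at_right 0. \<forall>x. L2_norm \<mu> M (weighted_deriv m \<alpha> (f \<epsilon>) x) \<le> \<bar>C\<bar> * \<epsilon> ^ p"
    using eventually_interval[of 1, OF zero_less_one]
  proof eventually_elim
    case (elim \<epsilon>)
    \<comment> \<open>Since \<epsilon> < 1, the lower power is the larger one;
      \<open>\<bar>C\<bar>\<close> provides the sign that monotonicity of products asks for.\<close>
    have "C * \<epsilon> ^ Suc p \<le> \<bar>C\<bar> * \<epsilon> ^ p"
      using elim(2) by (intro mult_mono power_decreasing) auto
    with elim(1) show ?case by (meson order_trans)
  qed
  then show "\<exists>C. \<forall>\<^sub>F \<epsilon> in at_right 0. \<forall>x. L2_norm \<mu> M (weighted_deriv m \<alpha> (f \<epsilon>) x) \<le> C * \<epsilon> ^ p" ..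
qed

text \<open>Invertibility is given by an inverse matrix \<open>b\<close>. This \<open>b\<close> is
  lower triangular as well, so the diagonal entries of the product of both matrices are
  \<open>a j j * b j j\<close>, and they equal 1.\<close>

lemma type_A_diagonal_nonzero:
  assumes "type_A_tableau s a_ex a" "j \<in> {1..s}"
  shows "a j j \<noteq> 0"
proof -
  obtain b where b: "\<And>j k. j \<in> {1..s} \<Longrightarrow> k \<in> {1..s} \<Longrightarrow>
      (\<Sum>l=1..s. a j l * b l k) = (if j = k then 1 else 0)"
    using assms(1) unfolding type_A_tableau_def by metis
  have tri: "a j k = 0" if "j \<in> {1..s}" "k \<in> {1..s}" "j < k" for j k
    using assms(1) that unfolding type_A_tableau_def by blast
  \<comment> \<open>Triangularity of \<open>b\<close> is part of the induction. In row j,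
    \<open>a j l\<close> vanishes for l > j, and \<open>b l k\<close> vanishes for l < j \<le> k by
    the induction hypothesis, so only the term l = j of the sum survives.\<close>
  have "a j j * b j j = 1 \<and> (\<forall>k\<in>{j<..s}. b j k = 0)" if "j \<in> {1..s}" for j
    using that
  proof (induction j rule: less_induct)
    case (less j)
    have row: "a j j * b j k = (if j = k then 1 else 0)" if k: "k \<in> {j..s}" for k
    proof -
      have "\<forall>l\<in>{1..s} - {j}. a j l * b l k = 0"
      proof
        fix l assume "l \<in> {1..s} - {j}"
        then show "a j l * b l k = 0"
          using less.IH[of l] tri[OF less.prems, of l] k by (cases "l < j") auto
      qed
      from sum.neutral[OF this] have "(\<Sum>l=1..s. a j l * b l k) = a j j * b j k"
        using less.prems by (subst sum.remove[of _ j]) simp_all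
      then show ?thesis
        using b[of j k] less.prems k by auto
    qed
    from row[of j] less.prems have "a j j * b j j = 1" by simp
    moreover have "b j k = 0" if "k \<in> {j<..s}" for k
      using row[of k] row[of j] that less.prems by auto
    ultimately show ?case by blast
  qed
  with assms(2) show ?thesis by fastforce
qed

lemma inner_grad: "v \<bullet> grad f x = (\<Sum>i\<in>UNIV. v $ i * partial i f x)"
  by (simp add: inner_vec_def grad_def)

lemma resolvent_stableD:
  assumes "resolvent_stable per \<mu> M D L c" "bigo_kinetic per \<mu> M p f"
    and "\<forall>\<^sub>F \<epsilon> in at_right 0. smooth_kinetic per \<mu> M (u \<epsilon>) \<and>
      (\<forall>x. vmean \<mu> M (f \<epsilon> x) = 0 \<and> vmean \<mu> M (u \<epsilon> x) = 0 \<and> u \<epsilon> x \<in> D \<and>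
        (AE v in \<mu>. \<epsilon>\<^sup>2 * u \<epsilon> x v - c * L (u \<epsilon> x) v = f \<epsilon> x v))"
  shows "bigo_kinetic per \<mu> M p u"
  using assms unfolding resolvent_stable_def by blast

lemma inverse_stableD:
  assumes "inverse_stable per \<mu> M D L" "bigo_kinetic per \<mu> M p f"
    and "\<forall>\<^sub>F \<epsilon> in at_right 0. smooth_kinetic per \<mu> M (u \<epsilon>) \<and>
      (\<forall>x. vmean \<mu> M (f \<epsilon> x) = 0 \<and> (AE v in \<mu>. u \<epsilon> x v = pseudo_inverse \<mu> M D L (f \<epsilon> x) v))"
  shows "bigo_kinetic per \<mu> M p u"
  using assms unfolding inverse_stable_def by blast

context kinetic_setting
begin

section \<open>The weighted space and its norm\<close>

lemma space_\<mu>: "space \<mu> = V"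
  using sets_eq_imp_space_eq[OF sets_\<mu>] by (simp add: space_restrict_space)

lemma M_pos_space: "v \<in> space \<mu> \<Longrightarrow> M v > 0"
  by (simp add: space_\<mu> M_pos)

lemma measurable_velocity [measurable]: "(\<lambda>v. v) \<in> borel_measurable \<mu>"
proof -
  have "(\<lambda>v. v) \<in> borel_measurable (restrict_space borel V)"
    by (rule measurable_restrict_space1) simp
  then show ?thesis
    by (subst measurable_cong_sets[OF sets_\<mu> refl])
qed

lemma measurable_velocity_component [measurable]: "(\<lambda>v. v $ i) \<in> borel_measurable \<mu>"
  by (intro borel_measurable_continuous_on[OF _ measurable_velocity] continuous_intros)

declare M_measurable [measurable]

lemma L2_measurable: "f \<in> L2 \<mu> M \<Longrightarrow> f \<in> borel_measurable \<mu>"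
  by (simp add: L2_def)

lemma L2_cong: "(\<And>v. v \<in> space \<mu> \<Longrightarrow> f v = h v) \<Longrightarrow> f \<in> L2 \<mu> M \<longleftrightarrow> h \<in> L2 \<mu> M"
  by (simp add: L2_def cong: measurable_cong Bochner_Integration.integrable_cong)

lemma L2_norm_cong: "(\<And>v. v \<in> space \<mu> \<Longrightarrow> f v = h v) \<Longrightarrow> L2_norm \<mu> M f = L2_norm \<mu> M h"
  by (simp add: L2_norm_def L2_inner_def cong: Bochner_Integration.integral_cong)

lemma L2_norm_nonneg: "L2_norm \<mu> M f \<ge> 0"
  unfolding L2_norm_def L2_inner_def
  by (intro real_sqrt_ge_zero Bochner_Integration.integral_nonneg_AE)
    (auto simp: less_imp_le[OF M_pos_space])

lemma L2_norm_square: "(L2_norm \<mu> M f)\<^sup>2 = (LINT v|\<mu>. (f v)\<^sup>2 / M v)"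
proof -
  have "(LINT v|\<mu>. (f v)\<^sup>2 / M v) \<ge> 0"
    by (intro Bochner_Integration.integral_nonneg_AE) (auto simp: less_imp_le[OF M_pos_space])
  then show ?thesis by (simp add: L2_norm_def L2_inner_def power2_eq_square)
qed

text \<open>A pointwise bound can be squared, divided by the positive \<open>M v\<close> and
  integrated. The estimates for multiplication by v and for products \<open>\<psi> v * h x\<close>
  come from here.\<close>

lemma L2_dominated:
  assumes f: "f \<in> borel_measurable \<mu>" and h: "h \<in> L2 \<mu> M" and "c \<ge> 0"
    and le: "\<And>v. v \<in> space \<mu> \<Longrightarrow> \<bar>f v\<bar> \<le> c * \<bar>h v\<bar>"
  shows "f \<in> L2 \<mu> M" "L2_norm \<mu> M f \<le> c * L2_norm \<mu> M h"
proof -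
  have sq: "(f v)\<^sup>2 / M v \<le> c\<^sup>2 * ((h v)\<^sup>2 / M v)" if "v \<in> space \<mu>" for v
  proof -
    have "\<bar>f v\<bar>\<^sup>2 \<le> (c * \<bar>h v\<bar>)\<^sup>2"
      using le[OF that] by (rule power_mono) simp
    then show ?thesis
      using M_pos_space[OF that] by (simp add: power_mult_distrib divide_right_mono)
  qed
  have int: "integrable \<mu> (\<lambda>v. c\<^sup>2 * ((h v)\<^sup>2 / M v))"
    using h by (intro integrable_mult_right) (simp add: L2_def)
  have int': "integrable \<mu> (\<lambda>v. (f v)\<^sup>2 / M v)"
    by (rule Bochner_Integration.integrable_bound[OF int])
      (use f sq in \<open>auto simp: less_imp_le[OF M_pos_space] abs_mult intro!: AE_I2\<close>)
  with f show "f \<in> L2 \<mu> M"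
    by (simp add: L2_def)
  have "(L2_norm \<mu> M f)\<^sup>2 \<le> (LINT v|\<mu>. c\<^sup>2 * ((h v)\<^sup>2 / M v))"
    unfolding L2_norm_square by (rule integral_mono[OF int' int sq])
  also have "\<dots> = (c * L2_norm \<mu> M h)\<^sup>2"
    by (simp add: L2_norm_square power_mult_distrib del: times_divide_eq_right)
  finally show "L2_norm \<mu> M f \<le> c * L2_norm \<mu> M h"
    using \<open>c \<ge> 0\<close> L2_norm_nonneg by (meson mult_nonneg_nonneg power2_le_imp_le)
qed

text \<open>Rests on \<open>(p + q)^2 \<le> 2 * p^2 + 2 * q^2\<close>, which is
  \<open>0 \<le> (p - q)^2\<close> rearranged. The factor 2 in the norm bound is harmless, as all
  later estimates are up to constants.\<close>

lemma L2_lincomb: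
  assumes f: "f \<in> L2 \<mu> M" and h: "h \<in> L2 \<mu> M"
  shows "(\<lambda>v. c1 * f v + c2 * h v) \<in> L2 \<mu> M"
    and "L2_norm \<mu> M (\<lambda>v. c1 * f v + c2 * h v) \<le> 2 * (\<bar>c1\<bar> * L2_norm \<mu> M f + \<bar>c2\<bar> * L2_norm \<mu> M h)"
proof -
  note [measurable] = L2_measurable[OF f] L2_measurable[OF h]
  let ?b = "\<lambda>v. 2 * c1\<^sup>2 * ((f v)\<^sup>2 / M v) + 2 * c2\<^sup>2 * ((h v)\<^sup>2 / M v)"
  have sq: "(c1 * f v + c2 * h v)\<^sup>2 / M v \<le> ?b v" if "v \<in> space \<mu>" for v
  proof -
    have "0 \<le> (c1 * f v - c2 * h v)\<^sup>2" by simp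
    then have "(c1 * f v + c2 * h v)\<^sup>2 \<le> 2 * c1\<^sup>2 * (f v)\<^sup>2 + 2 * c2\<^sup>2 * (h v)\<^sup>2"
      by (simp add: power2_eq_square algebra_simps)
    then have "(c1 * f v + c2 * h v)\<^sup>2 / M v \<le> (2 * c1\<^sup>2 * (f v)\<^sup>2 + 2 * c2\<^sup>2 * (h v)\<^sup>2) / M v"
      using M_pos_space[OF that] by (simp add: divide_right_mono)
    then show ?thesis by (simp add: add_divide_distrib)
  qed
  have intf: "integrable \<mu> (\<lambda>v. (f v)\<^sup>2 / M v)" and inth: "integrable \<mu> (\<lambda>v. (h v)\<^sup>2 / M v)"
    using f h by (auto simp: L2_def)
  then have int: "integrable \<mu> ?b"
    by (intro Bochner_Integration.integrable_add integrable_mult_right)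
  have int': "integrable \<mu> (\<lambda>v. (c1 * f v + c2 * h v)\<^sup>2 / M v)"
    by (rule Bochner_Integration.integrable_bound[OF int])
      (use sq in \<open>force simp: less_imp_le[OF M_pos_space] intro!: AE_I2\<close>)+
  then show "(\<lambda>v. c1 * f v + c2 * h v) \<in> L2 \<mu> M"
    by (simp add: L2_def)
  let ?F = "L2_norm \<mu> M f" and ?H = "L2_norm \<mu> M h"
  have "(L2_norm \<mu> M (\<lambda>v. c1 * f v + c2 * h v))\<^sup>2 \<le> (LINT v|\<mu>. ?b v)"
    unfolding L2_norm_square by (rule integral_mono[OF int' int sq])
  also have "\<dots> = 2 * c1\<^sup>2 * ?F\<^sup>2 + 2 * c2\<^sup>2 * ?H\<^sup>2"
    using intf inth by (simp add: L2_norm_square del: times_divide_eq_right)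
  also have "\<dots> \<le> (2 * (\<bar>c1\<bar> * ?F + \<bar>c2\<bar> * ?H))\<^sup>2"
  proof -
    \<comment> \<open>This is the right-hand side minus the left-hand side after expanding the
      square.\<close>
    have "0 \<le> 2 * (c1\<^sup>2 * ?F\<^sup>2) + 2 * (c2\<^sup>2 * ?H\<^sup>2) + 8 * ((\<bar>c1\<bar> * ?F) * (\<bar>c2\<bar> * ?H))"
      using L2_norm_nonneg by (intro add_nonneg_nonneg mult_nonneg_nonneg) auto
    then show ?thesis
      by (simp add: power2_sum power_mult_distrib)
  qed
  finally show "L2_norm \<mu> M (\<lambda>v. c1 * f v + c2 * h v) \<le> 2 * (\<bar>c1\<bar> * ?F + \<bar>c2\<bar> * ?H)"
    using L2_norm_nonneg by (rule_tac power2_le_imp_le) auto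
qed

text \<open>\<open>M\<close> is integrable, being its own moment of order 0, and
  \<open>\<bar>f v\<bar> \<le> (f v)^2 / M v + M v\<close> by the inequality between the arithmetic
  and the geometric mean.\<close>

lemma L2_integrable:
  assumes f: "f \<in> L2 \<mu> M" shows "integrable \<mu> f"
proof (rule Bochner_Integration.integrable_bound)
  show "integrable \<mu> (\<lambda>v. (f v)\<^sup>2 / M v + M v)"
    using f M_moments[of 0] by (simp add: L2_def)
  show "AE v in \<mu>. norm (f v) \<le> norm ((f v)\<^sup>2 / M v + M v)"
  proof (rule AE_I2)
    fix v assume "v \<in> space \<mu>"
    then have M: "M v > 0" by (rule M_pos_space)
    have "0 \<le> (\<bar>f v\<bar> - M v)\<^sup>2" by simp
    then have "2 * \<bar>f v\<bar> * M v \<le> (f v)\<^sup>2 + M v * M v"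
      by (simp add: power2_eq_square algebra_simps)
    moreover have "\<bar>f v\<bar> * M v \<ge> 0" using M by simp
    ultimately have "\<bar>f v\<bar> * M v \<le> (f v)\<^sup>2 + M v * M v" by simp
    then have "\<bar>f v\<bar> \<le> (f v)\<^sup>2 / M v + M v"
      using M by (simp add: field_simps)
    then show "norm (f v) \<le> norm ((f v)\<^sup>2 / M v + M v)" by simp
  qed
qed (use f in \<open>simp add: L2_measurable\<close>)

section \<open>Velocity averages and rapidly decaying velocity factors\<close>

lemma vmean_lincomb:
  fixes f h :: "real^'d \<Rightarrow> real"
  assumes "integrable \<mu> f" "integrable \<mu> h"
  shows "vmean \<mu> M (\<lambda>v. c1 * f v + c2 * h v) = c1 * vmean \<mu> M f + c2 * vmean \<mu> M h"
  using assms by (simp add: vmean_def algebra_simps)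

lemma vmean_sum:
  fixes f :: "'k \<Rightarrow> real^'d \<Rightarrow> real"
  assumes "\<And>k. k \<in> S \<Longrightarrow> integrable \<mu> (f k)"
  shows "vmean \<mu> M (\<lambda>v. \<Sum>k\<in>S. c k * f k v) = (\<Sum>k\<in>S. c k * vmean \<mu> M (f k))"
  using assms by (simp add: vmean_def sum_distrib_left mult.left_commute)

lemma vmean_cong_AE:
  fixes f h :: "real^'d \<Rightarrow> real"
  assumes "AE v in \<mu>. f v = h v" "f \<in> borel_measurable \<mu>" "h \<in> borel_measurable \<mu>"
  shows "vmean \<mu> M f = vmean \<mu> M h"
  using integral_cong_AE[OF assms(2,3,1)] by (simp add: vmean_def)

lemma rapid_L2: "rapid \<mu> M \<psi> \<Longrightarrow> \<psi> \<in> L2 \<mu> M"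
  unfolding rapid_def by (drule spec[of _ 0]) simp

lemmas rapid_measurable = L2_measurable[OF rapid_L2]
  and rapid_integrable = L2_integrable[OF rapid_L2]

text \<open>Since \<open>\<bar>v $ i\<bar> \<le> norm v\<close>, the new factor is absorbed by one
  more power of the weight.\<close>

lemma rapid_vmult:
  assumes "rapid \<mu> M \<psi>" shows "rapid \<mu> M (\<lambda>v. v $ i * \<psi> v)"
  unfolding rapid_def
proof
  fix m
  note [measurable] = rapid_measurable[OF assms]
  show "(\<lambda>v. norm v ^ m * (v $ i * \<psi> v)) \<in> L2 \<mu> M"
  proof (rule L2_dominated(1))
    show "(\<lambda>v. norm v ^ Suc m * \<psi> v) \<in> L2 \<mu> M"
      using assms unfolding rapid_def by (rule spec)
    show "\<bar>norm v ^ m * (v $ i * \<psi> v)\<bar> \<le> 1 * \<bar>norm v ^ Suc m * \<psi> v\<bar>" for v :: "real^'d"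
      using mult_right_mono[OF component_le_norm_cart[of v i], of "norm v ^ m * \<bar>\<psi> v\<bar>"]
      by (simp add: abs_mult mult_ac)
  qed auto
qed

lemma rapid_lincomb:
  assumes "rapid \<mu> M \<psi>" "rapid \<mu> M \<phi>" shows "rapid \<mu> M (\<lambda>v. c1 * \<psi> v + c2 * \<phi> v)"
  unfolding rapid_def
proof
  fix m
  have "(\<lambda>v. c1 * (norm v ^ m * \<psi> v) + c2 * (norm v ^ m * \<phi> v)) \<in> L2 \<mu> M"
    using assms by (intro L2_lincomb) (auto simp: rapid_def)
  then show "(\<lambda>v. norm v ^ m * (c1 * \<psi> v + c2 * \<phi> v)) \<in> L2 \<mu> M"
    by (simp add: algebra_simps)
qed

text \<open>Squaring \<open>norm v ^ m * M v\<close> and dividing by \<open>M v\<close> leaves the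
  moment of \<open>M\<close> of order 2 m.\<close>

lemma rapid_M: "rapid \<mu> M M"
  unfolding rapid_def
proof
  fix m
  have "integrable \<mu> (\<lambda>v. (norm v ^ m * M v)\<^sup>2 / M v) \<longleftrightarrow> integrable \<mu> (\<lambda>v. norm v ^ (2 * m) * M v)"
  proof (rule Bochner_Integration.integrable_cong)
    fix v assume "v \<in> space \<mu>"
    then show "(norm v ^ m * M v)\<^sup>2 / M v = norm v ^ (2 * m) * M v"
      using M_pos_space[of v] by (simp add: power_mult_distrib power2_eq_square power_mult power_even_eq)
  qed simp
  then show "(\<lambda>v. norm v ^ m * M v) \<in> L2 \<mu> M"
    using M_moments by (simp add: L2_def)
qed

text \<open>Meant for values of \<open>pseudo_inverse\<close>, which are known only up to null sets.
  Measurability is asked separately because equality almost everywhere need not transfer it.\<close>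

lemma rapid_cong_AE:
  assumes "AE v in \<mu>. \<psi> v = \<phi> v" "rapid \<mu> M \<phi>" and [measurable]: "\<psi> \<in> borel_measurable \<mu>"
  shows "rapid \<mu> M \<psi>"
  unfolding rapid_def
proof
  fix m
  note [measurable] = rapid_measurable[OF assms(2)]
  have "integrable \<mu> (\<lambda>v. (norm v ^ m * \<phi> v)\<^sup>2 / M v)"
    using assms(2) by (auto simp: rapid_def L2_def)
  then have "integrable \<mu> (\<lambda>v. (norm v ^ m * \<psi> v)\<^sup>2 / M v)"
    by (rule integrable_cong_AE_imp) (use assms(1) in auto)
  then show "(\<lambda>v. norm v ^ m * \<psi> v) \<in> L2 \<mu> M"
    by (simp add: L2_def)
qed

text \<open>Taking a component is bounded linear and commutes with the integral once
  \<open>\<psi> v *\<^sub>R v\<close> is integrable; this is the weight m = 1 in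
  \<open>rapid\<close>.\<close>

lemma vmean_velocity:
  assumes "rapid \<mu> M \<psi>"
  shows "vmean \<mu> M (\<lambda>v. \<psi> v *\<^sub>R v) $ i = vmean \<mu> M (\<lambda>v. v $ i * \<psi> v)"
proof -
  note [measurable] = rapid_measurable[OF assms]
  have "integrable \<mu> (\<lambda>v. norm v ^ 1 * \<psi> v)"
    using assms L2_integrable unfolding rapid_def by blast
  then have "integrable \<mu> (\<lambda>v. \<psi> v *\<^sub>R v)"
    by (rule Bochner_Integration.integrable_bound) (auto simp: abs_mult)
  then have "(LINT v|\<mu>. \<psi> v *\<^sub>R v) $ i = (LINT v|\<mu>. (\<psi> v *\<^sub>R v) $ i)"
    by (rule integral_bounded_linear[OF bounded_linear_vec_nth, symmetric])
  then show ?thesis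
    by (simp add: vmean_def mult.commute)
qed

lemma vM_component_mean: "vmean \<mu> M (\<lambda>v. v $ i * M v) = 0"
  using vM_mean vmean_velocity[OF rapid_M, of i] by simp

section \<open>Weighted x-derivatives and closure properties of smooth kinetic functions\<close>

lemma weighted_deriv_lincomb:
  assumes "smooth_kinetic per \<mu> M f" "smooth_kinetic per \<mu> M h"
  shows "weighted_deriv m \<alpha> (\<lambda>x v. c1 * f x v + c2 * h x v) x \<in> L2 \<mu> M" (is "?w \<in> _")
    and "L2_norm \<mu> M (weighted_deriv m \<alpha> (\<lambda>x v. c1 * f x v + c2 * h x v) x)
      \<le> 2 * (\<bar>c1\<bar> * L2_norm \<mu> M (weighted_deriv m \<alpha> f x) + \<bar>c2\<bar> * L2_norm \<mu> M (weighted_deriv m \<alpha> h x))"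
proof -
  have eq: "?w v = c1 * weighted_deriv m \<alpha> f x v + c2 * weighted_deriv m \<alpha> h x v"
    if "v \<in> space \<mu>" for v
    using smooth_macro_iter_lincomb[OF assms[THEN smooth_kineticD(1), OF that]]
    by (simp add: weighted_deriv_def algebra_simps)
  show "?w \<in> L2 \<mu> M"
    by (subst L2_cong[OF eq]) (auto intro!: L2_lincomb smooth_kineticD(2) assms)
  show "L2_norm \<mu> M ?w \<le> 2 * (\<bar>c1\<bar> * L2_norm \<mu> M (weighted_deriv m \<alpha> f x)
      + \<bar>c2\<bar> * L2_norm \<mu> M (weighted_deriv m \<alpha> h x))"
    by (subst L2_norm_cong[OF eq]) (assumption, rule L2_lincomb(2)[OF assms[THEN smooth_kineticD(2)]])
qed

lemma weighted_deriv_vmult: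
  assumes "smooth_kinetic per \<mu> M f"
  shows "weighted_deriv m \<alpha> (\<lambda>x v. v $ i * f x v) x \<in> L2 \<mu> M" (is "?w \<in> _")
    and "L2_norm \<mu> M (weighted_deriv m \<alpha> (\<lambda>x v. v $ i * f x v) x)
      \<le> L2_norm \<mu> M (weighted_deriv (Suc m) \<alpha> f x)"
proof -
  have eq: "?w v = v $ i * weighted_deriv m \<alpha> f x v" if "v \<in> space \<mu>" for v
    using smooth_macro_iter_cmult[OF smooth_kineticD(1)[OF assms that]]
    by (simp add: weighted_deriv_def)
  note [measurable] = L2_measurable[OF smooth_kineticD(2)[OF assms]]
  have le: "\<bar>v $ i * weighted_deriv m \<alpha> f x v\<bar> \<le> 1 * \<bar>weighted_deriv (Suc m) \<alpha> f x v\<bar>" for v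
    using mult_right_mono[OF component_le_norm_cart[of v i], of "\<bar>weighted_deriv m \<alpha> f x v\<bar>"]
    by (simp add: weighted_deriv_def abs_mult mult_ac)
  have "(\<lambda>v. v $ i * weighted_deriv m \<alpha> f x v) \<in> borel_measurable \<mu>" by measurable
  note * = L2_dominated[OF this smooth_kineticD(2)[OF assms] zero_le_one le]
  show "?w \<in> L2 \<mu> M"
    using *(1) by (subst L2_cong[OF eq])
  show "L2_norm \<mu> M ?w \<le> L2_norm \<mu> M (weighted_deriv (Suc m) \<alpha> f x)"
    using *(2) by (subst L2_norm_cong[OF eq]) simp_all
qed

text \<open>All x-derivatives fall on \<open>h\<close>, and all powers of v fall on
  \<open>\<psi>\<close>.\<close>

lemma weighted_deriv_tensor:
  assumes "smooth_macro per h" "rapid \<mu> M \<psi>"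
  shows "weighted_deriv m \<alpha> (\<lambda>x v. \<psi> v * h x) x \<in> L2 \<mu> M" (is "?w \<in> _")
    and "L2_norm \<mu> M (weighted_deriv m \<alpha> (\<lambda>x v. \<psi> v * h x) x)
      \<le> \<bar>iter_partial \<alpha> h x\<bar> * L2_norm \<mu> M (\<lambda>v. norm v ^ m * \<psi> v)"
proof -
  have eq: "?w = (\<lambda>v. iter_partial \<alpha> h x * (norm v ^ m * \<psi> v))"
    using smooth_macro_iter_cmult[OF assms(1)] by (simp add: weighted_deriv_def fun_eq_iff)
  have "(\<lambda>v. norm v ^ m * \<psi> v) \<in> L2 \<mu> M"
    using assms(2) unfolding rapid_def by (rule spec)
  note * = this L2_measurable[OF this]
  have **: "(\<lambda>v. iter_partial \<alpha> h x * (norm v ^ m * \<psi> v)) \<in> borel_measurable \<mu>"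
    using *(2) by (rule borel_measurable_times[OF borel_measurable_const])
  show "?w \<in> L2 \<mu> M"
    unfolding eq by (rule L2_dominated(1)[OF ** *(1) abs_ge_zero[of "iter_partial \<alpha> h x"]])
      (simp add: abs_mult)
  show "L2_norm \<mu> M ?w \<le> \<bar>iter_partial \<alpha> h x\<bar> * L2_norm \<mu> M (\<lambda>v. norm v ^ m * \<psi> v)"
    unfolding eq by (rule L2_dominated(2)[OF ** *(1) abs_ge_zero]) (simp add: abs_mult)
qed

lemma weighted_deriv_partial:
  "weighted_deriv m \<alpha> (\<lambda>x v. partial i (\<lambda>y. f y v) x) = weighted_deriv m (\<alpha> @ [i]) f"
  by (simp add: weighted_deriv_def[abs_def] fun_eq_iff flip: iter_partial_partial)

lemma smooth_kinetic_lincomb: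
  assumes "smooth_kinetic per \<mu> M f" "smooth_kinetic per \<mu> M h"
  shows "smooth_kinetic per \<mu> M (\<lambda>x v. c1 * f x v + c2 * h x v)"
  unfolding smooth_kinetic_def
proof (intro conjI ballI allI)
  show "smooth_macro per (\<lambda>x. c1 * f x v + c2 * h x v)" if "v \<in> space \<mu>" for v
    using that by (intro smooth_macro_lincomb assms[THEN smooth_kineticD(1)])
  fix m and \<alpha> :: "'d list"
  obtain C1 where C1: "\<And>x. L2_norm \<mu> M (weighted_deriv m \<alpha> f x) \<le> C1"
    using assms(1) smooth_kinetic_boundE by blast
  obtain C2 where C2: "\<And>x. L2_norm \<mu> M (weighted_deriv m \<alpha> h x) \<le> C2"
    using assms(2) smooth_kinetic_boundE by blast
  have "L2_norm \<mu> M (weighted_deriv m \<alpha> (\<lambda>x v. c1 * f x v + c2 * h x v) x)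
      \<le> 2 * (\<bar>c1\<bar> * C1 + \<bar>c2\<bar> * C2)" for x
    by (rule order_trans[OF weighted_deriv_lincomb(2)[OF assms]])
      (intro mult_left_mono add_mono C1 C2; simp)
  then show "\<exists>C. \<forall>x. L2_norm \<mu> M (weighted_deriv m \<alpha> (\<lambda>x v. c1 * f x v + c2 * h x v) x) \<le> C"
    by blast
qed (rule weighted_deriv_lincomb(1)[OF assms])

lemma smooth_kinetic_vmult:
  assumes "smooth_kinetic per \<mu> M f"
  shows "smooth_kinetic per \<mu> M (\<lambda>x v. v $ i * f x v)"
  unfolding smooth_kinetic_def
proof (intro conjI ballI allI)
  show "smooth_macro per (\<lambda>x. v $ i * f x v)" if "v \<in> space \<mu>" for v
    using that by (intro smooth_macro_cmult smooth_kineticD(1)[OF assms])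
  show "\<exists>C. \<forall>x. L2_norm \<mu> M (weighted_deriv m \<alpha> (\<lambda>x v. v $ i * f x v) x) \<le> C" for m \<alpha>
    using weighted_deriv_vmult(2)[OF assms] smooth_kinetic_boundE[OF assms]
    by (meson order_trans)
qed (rule weighted_deriv_vmult(1)[OF assms])

lemma smooth_kinetic_partial:
  assumes "smooth_kinetic per \<mu> M f"
  shows "smooth_kinetic per \<mu> M (\<lambda>x v. partial i (\<lambda>y. f y v) x)"
  using assms unfolding smooth_kinetic_def weighted_deriv_partial
  by (auto intro: smooth_macro_partial)

lemma smooth_kinetic_tensor:
  assumes "smooth_macro per h" "rapid \<mu> M \<psi>"
  shows "smooth_kinetic per \<mu> M (\<lambda>x v. \<psi> v * h x)"
  unfolding smooth_kinetic_def
proof (intro conjI ballI allI)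
  show "smooth_macro per (\<lambda>x. \<psi> v * h x)" for v
    by (intro smooth_macro_cmult assms)
  fix m and \<alpha> :: "'d list"
  obtain C where "\<And>x. \<bar>iter_partial \<alpha> h x\<bar> \<le> C"
    using smooth_macro_bounded[OF assms(1) per_pos] by blast
  then have "L2_norm \<mu> M (weighted_deriv m \<alpha> (\<lambda>x v. \<psi> v * h x) x)
      \<le> C * L2_norm \<mu> M (\<lambda>v. norm v ^ m * \<psi> v)" for x
    by (rule order_trans[OF weighted_deriv_tensor(2)[OF assms] mult_right_mono])
      (rule L2_norm_nonneg)
  then show "\<exists>C. \<forall>x. L2_norm \<mu> M (weighted_deriv m \<alpha> (\<lambda>x v. \<psi> v * h x) x) \<le> C"
    by blast
qed (rule weighted_deriv_tensor(1)[OF assms])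

section \<open>Order estimates for families of kinetic functions\<close>

lemma bigo_kinetic_lincomb:
  assumes "bigo_kinetic per \<mu> M p f" "bigo_kinetic per \<mu> M p h"
  shows "bigo_kinetic per \<mu> M p (\<lambda>\<epsilon> x v. c1 * f \<epsilon> x v + c2 * h \<epsilon> x v)"
  unfolding bigo_kinetic_def
proof safe
  show "\<forall>\<^sub>F \<epsilon> in at_right 0. smooth_kinetic per \<mu> M (\<lambda>x v. c1 * f \<epsilon> x v + c2 * h \<epsilon> x v)"
    using assms[THEN bigo_kineticD] by eventually_elim (rule smooth_kinetic_lincomb)
  fix m and \<alpha> :: "'d list"
  obtain C1 where C1: "\<forall>\<^sub>F \<epsilon> in at_right 0. \<forall>x. L2_norm \<mu> M (weighted_deriv m \<alpha> (f \<epsilon>) x) \<le> C1 * \<epsilon> ^ p"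
    using assms(1) by (rule bigo_kinetic_boundE)
  obtain C2 where "\<forall>\<^sub>F \<epsilon> in at_right 0. \<forall>x. L2_norm \<mu> M (weighted_deriv m \<alpha> (h \<epsilon>) x) \<le> C2 * \<epsilon> ^ p"
    using assms(2) by (rule bigo_kinetic_boundE)
  with C1 assms[THEN bigo_kineticD]
  have "\<forall>\<^sub>F \<epsilon> in at_right 0. \<forall>x.
      L2_norm \<mu> M (weighted_deriv m \<alpha> (\<lambda>x v. c1 * f \<epsilon> x v + c2 * h \<epsilon> x v) x)
      \<le> (2 * (\<bar>c1\<bar> * C1 + \<bar>c2\<bar> * C2)) * \<epsilon> ^ p"
  proof eventually_elim
    case (elim \<epsilon>)
    show ?case
    proof
      fix x
      have "L2_norm \<mu> M (weighted_deriv m \<alpha> (\<lambda>x v. c1 * f \<epsilon> x v + c2 * h \<epsilon> x v) x)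
          \<le> 2 * (\<bar>c1\<bar> * (C1 * \<epsilon> ^ p) + \<bar>c2\<bar> * (C2 * \<epsilon> ^ p))"
        by (rule order_trans[OF weighted_deriv_lincomb(2)[OF elim(2,3)]])
          (intro mult_left_mono add_mono elim(1,4)[rule_format]; simp)
      then show "L2_norm \<mu> M (weighted_deriv m \<alpha> (\<lambda>x v. c1 * f \<epsilon> x v + c2 * h \<epsilon> x v) x)
          \<le> (2 * (\<bar>c1\<bar> * C1 + \<bar>c2\<bar> * C2)) * \<epsilon> ^ p"
        by (simp add: algebra_simps)
    qed
  qed
  then show "\<exists>C. \<forall>\<^sub>F \<epsilon> in at_right 0. \<forall>x.
      L2_norm \<mu> M (weighted_deriv m \<alpha> (\<lambda>x v. c1 * f \<epsilon> x v + c2 * h \<epsilon> x v) x) \<le> C * \<epsilon> ^ p" ..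
qed

lemma bigo_kinetic_cmult:
  "bigo_kinetic per \<mu> M p f \<Longrightarrow> bigo_kinetic per \<mu> M p (\<lambda>\<epsilon> x v. c * f \<epsilon> x v)"
  using bigo_kinetic_lincomb[of p f f c 0] by simp

lemma bigo_kinetic_add:
  "bigo_kinetic per \<mu> M p f \<Longrightarrow> bigo_kinetic per \<mu> M p h \<Longrightarrow>
    bigo_kinetic per \<mu> M p (\<lambda>\<epsilon> x v. f \<epsilon> x v + h \<epsilon> x v)"
  using bigo_kinetic_lincomb[of p f h 1 1] by simp

lemma bigo_kinetic_diff:
  "bigo_kinetic per \<mu> M p f \<Longrightarrow> bigo_kinetic per \<mu> M p h \<Longrightarrow>
    bigo_kinetic per \<mu> M p (\<lambda>\<epsilon> x v. f \<epsilon> x v - h \<epsilon> x v)"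
  using bigo_kinetic_lincomb[of p f h 1 "-1"] by simp

lemma bigo_kinetic_zero: "bigo_kinetic per \<mu> M p (\<lambda>\<epsilon> x v. 0)"
proof -
  have z: "(\<lambda>v. 0) \<in> L2 \<mu> M" by (simp add: L2_def)
  have "weighted_deriv m \<alpha> (\<lambda>x v. 0) = (\<lambda>x v. 0)" for m and \<alpha> :: "'d list"
    by (simp add: weighted_deriv_def[abs_def])
  then show ?thesis
    by (auto simp: bigo_kinetic_def smooth_kinetic_def z L2_norm_def L2_inner_def intro!: exI[of _ 0])
qed

lemma bigo_kinetic_sum:
  assumes "finite S" "\<And>k. k \<in> S \<Longrightarrow> bigo_kinetic per \<mu> M p (f k)"
  shows "bigo_kinetic per \<mu> M p (\<lambda>\<epsilon> x v. \<Sum>k\<in>S. f k \<epsilon> x v)"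
  using assms
proof (induction S)
  case (insert k S)
  then show ?case using bigo_kinetic_add[of p "f k" "\<lambda>\<epsilon> x v. \<Sum>k\<in>S. f k \<epsilon> x v"] by simp
qed (simp add: bigo_kinetic_zero)

lemma bigo_kinetic_eps:
  assumes "bigo_kinetic per \<mu> M p f"
  shows "bigo_kinetic per \<mu> M (q + p) (\<lambda>\<epsilon> x v. \<epsilon> ^ q * f \<epsilon> x v)"
  unfolding bigo_kinetic_def
proof safe
  have sm: "smooth_kinetic per \<mu> M (\<lambda>x v. c * h x v)" if "smooth_kinetic per \<mu> M h" for c h
    using smooth_kinetic_lincomb[OF that that, of c 0] by simp
  show "\<forall>\<^sub>F \<epsilon> in at_right 0. smooth_kinetic per \<mu> M (\<lambda>x v. \<epsilon> ^ q * f \<epsilon> x v)"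
    using bigo_kineticD[OF assms] by eventually_elim (rule sm)
  fix m and \<alpha> :: "'d list"
  obtain C where "\<forall>\<^sub>F \<epsilon> in at_right 0. \<forall>x. L2_norm \<mu> M (weighted_deriv m \<alpha> (f \<epsilon>) x) \<le> C * \<epsilon> ^ p"
    using assms by (rule bigo_kinetic_boundE)
  with bigo_kineticD[OF assms] eventually_pos
  have "\<forall>\<^sub>F \<epsilon> in at_right 0. \<forall>x. L2_norm \<mu> M (weighted_deriv m \<alpha> (\<lambda>x v. \<epsilon> ^ q * f \<epsilon> x v) x)
      \<le> (2 * C) * \<epsilon> ^ (q + p)"
  proof eventually_elim
    case (elim \<epsilon>)
    show ?case
    proof
      fix x
      \<comment> \<open>The factor 2 is inherited from the bound for linear combinations, used here
        with second coefficient 0.\<close>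
      have "L2_norm \<mu> M (weighted_deriv m \<alpha> (\<lambda>x v. \<epsilon> ^ q * f \<epsilon> x v) x)
          \<le> 2 * (\<bar>\<epsilon> ^ q\<bar> * L2_norm \<mu> M (weighted_deriv m \<alpha> (f \<epsilon>) x))"
        using weighted_deriv_lincomb(2)[OF elim(1) elim(1), of m \<alpha> "\<epsilon> ^ q" 0 x] by simp
      also have "\<dots> \<le> 2 * (\<epsilon> ^ q * (C * \<epsilon> ^ p))"
        using elim(2,3) by (simp add: abs_of_pos)
      finally show "L2_norm \<mu> M (weighted_deriv m \<alpha> (\<lambda>x v. \<epsilon> ^ q * f \<epsilon> x v) x)
          \<le> (2 * C) * \<epsilon> ^ (q + p)"
        by (simp add: power_add algebra_simps)
    qed
  qed
  then show "\<exists>C. \<forall>\<^sub>F \<epsilon> in at_right 0. \<forall>x.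
      L2_norm \<mu> M (weighted_deriv m \<alpha> (\<lambda>x v. \<epsilon> ^ q * f \<epsilon> x v) x) \<le> C * \<epsilon> ^ (q + p)" ..
qed

lemma bigo_kinetic_vmult:
  assumes "bigo_kinetic per \<mu> M p f"
  shows "bigo_kinetic per \<mu> M p (\<lambda>\<epsilon> x v. v $ i * f \<epsilon> x v)"
  unfolding bigo_kinetic_def
proof safe
  show "\<forall>\<^sub>F \<epsilon> in at_right 0. smooth_kinetic per \<mu> M (\<lambda>x v. v $ i * f \<epsilon> x v)"
    using bigo_kineticD[OF assms] by eventually_elim (rule smooth_kinetic_vmult)
  fix m and \<alpha> :: "'d list"
  obtain C where "\<forall>\<^sub>F \<epsilon> in at_right 0. \<forall>x.
      L2_norm \<mu> M (weighted_deriv (Suc m) \<alpha> (f \<epsilon>) x) \<le> C * \<epsilon> ^ p"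
    using assms by (rule bigo_kinetic_boundE)
  with bigo_kineticD[OF assms] have "\<forall>\<^sub>F \<epsilon> in at_right 0. \<forall>x.
      L2_norm \<mu> M (weighted_deriv m \<alpha> (\<lambda>x v. v $ i * f \<epsilon> x v) x) \<le> C * \<epsilon> ^ p"
    by eventually_elim (blast intro: order_trans weighted_deriv_vmult(2))
  then show "\<exists>C. \<forall>\<^sub>F \<epsilon> in at_right 0. \<forall>x.
      L2_norm \<mu> M (weighted_deriv m \<alpha> (\<lambda>x v. v $ i * f \<epsilon> x v) x) \<le> C * \<epsilon> ^ p" ..
qed

lemma bigo_kinetic_partial:
  assumes "bigo_kinetic per \<mu> M p f"
  shows "bigo_kinetic per \<mu> M p (\<lambda>\<epsilon> x v. partial i (\<lambda>y. f \<epsilon> y v) x)"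
  using assms unfolding bigo_kinetic_def weighted_deriv_partial
  by (auto elim: eventually_mono intro: smooth_kinetic_partial)

lemma bigo_kinetic_tensor:
  assumes "bigo_macro per p h" "rapid \<mu> M \<psi>"
  shows "bigo_kinetic per \<mu> M p (\<lambda>\<epsilon> x v. \<psi> v * h \<epsilon> x)"
  unfolding bigo_kinetic_def
proof safe
  show "\<forall>\<^sub>F \<epsilon> in at_right 0. smooth_kinetic per \<mu> M (\<lambda>x v. \<psi> v * h \<epsilon> x)"
    using bigo_macroD[OF assms(1)] by eventually_elim (rule smooth_kinetic_tensor[OF _ assms(2)])
  fix m and \<alpha> :: "'d list"
  let ?N = "L2_norm \<mu> M (\<lambda>v. norm v ^ m * \<psi> v)"
  obtain C where "\<forall>\<^sub>F \<epsilon> in at_right 0. \<forall>x. \<bar>iter_partial \<alpha> (h \<epsilon>) x\<bar> \<le> C * \<epsilon> ^ p"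
    using assms(1) by (rule bigo_macro_boundE)
  with bigo_macroD[OF assms(1)] have "\<forall>\<^sub>F \<epsilon> in at_right 0. \<forall>x.
      L2_norm \<mu> M (weighted_deriv m \<alpha> (\<lambda>x v. \<psi> v * h \<epsilon> x) x) \<le> (C * ?N) * \<epsilon> ^ p"
  proof eventually_elim
    case (elim \<epsilon>)
    have "L2_norm \<mu> M (weighted_deriv m \<alpha> (\<lambda>x v. \<psi> v * h \<epsilon> x) x) \<le> (C * \<epsilon> ^ p) * ?N" for x
      by (rule order_trans[OF weighted_deriv_tensor(2)[OF elim(1) assms(2)] mult_right_mono])
        (use elim(2) L2_norm_nonneg in auto)
    then show ?case by (simp add: mult_ac)
  qed
  then show "\<exists>C. \<forall>\<^sub>F \<epsilon> in at_right 0. \<forall>x.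
      L2_norm \<mu> M (weighted_deriv m \<alpha> (\<lambda>x v. \<psi> v * h \<epsilon> x) x) \<le> C * \<epsilon> ^ p" ..
qed

section \<open>The collision operator and its pseudo-inverse\<close>

text \<open>The graph of \<open>L\<close> up to null sets. Values of \<open>L\<close> matter only
  almost everywhere, so \<open>h\<close> may be any representative of the image, in particular one
  that is smooth in x.\<close>

definition L_maps :: "(real^'d \<Rightarrow> real) \<Rightarrow> (real^'d \<Rightarrow> real) \<Rightarrow> bool" where
  "L_maps f h \<longleftrightarrow> f \<in> D \<and> (AE v in \<mu>. L f v = h v)"

text \<open>The functions on which \<open>L\<close> is inverted. Including \<open>rapid\<close>
  guarantees integrability, so that averages are additive on this class.\<close>

definition mean_free :: "(real^'d \<Rightarrow> real) \<Rightarrow> bool" where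
  "mean_free f \<longleftrightarrow> rapid \<mu> M f \<and> vmean \<mu> M f = 0"

lemma domain_measurable: "f \<in> D \<Longrightarrow> f \<in> borel_measurable \<mu>"
  using domain L2_measurable by blast

lemma L_maps_M: "L_maps M (\<lambda>v. 0)"
proof -
  have "\<exists>c. AE v in \<mu>. M v = c * M v" by (rule exI[of _ 1]) simp
  then show ?thesis
    using null_space[OF rapid_L2[OF rapid_M]] unfolding L_maps_def by blast
qed

lemma L_maps_lincomb:
  assumes "L_maps f h" "L_maps f' h'"
  shows "L_maps (\<lambda>v. c1 * f v + c2 * f' v) (\<lambda>v. c1 * h v + c2 * h' v)"
proof -
  have D: "f \<in> D" "f' \<in> D" and eq: "AE v in \<mu>. L f v = h v" "AE v in \<mu>. L f' v = h' v"
    using assms by (auto simp: L_maps_def)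
  have "AE v in \<mu>. L (\<lambda>v. c1 * f v + c2 * f' v) v = c1 * h v + c2 * h' v"
    using linear[OF D, of c1 c2] eq by eventually_elim simp
  with domain_subspace[OF D] show ?thesis
    by (simp add: L_maps_def)
qed

lemma L_maps_sum:
  assumes "finite S" "\<And>k. k \<in> S \<Longrightarrow> L_maps (f k) (h k)"
  shows "L_maps (\<lambda>v. \<Sum>k\<in>S. c k * f k v) (\<lambda>v. \<Sum>k\<in>S. c k * h k v)"
  using assms
proof (induction S)
  case empty
  \<comment> \<open>The zero function is obtained as a trivial combination of \<open>M\<close>, a
    known element of the domain.\<close>
  show ?case using L_maps_lincomb[OF L_maps_M L_maps_M, of 0 0] by simp
next
  case (insert k S)
  then show ?case
    using L_maps_lincomb[of "f k" "h k" "\<lambda>v. \<Sum>k\<in>S. c k * f k v" "\<lambda>v. \<Sum>k\<in>S. c k * h k v" "c k" 1]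
    by simp
qed

lemma L_maps_cong_AE: "L_maps f h \<Longrightarrow> AE v in \<mu>. h v = h' v \<Longrightarrow> L_maps f h'"
  unfolding L_maps_def by (auto elim: AE_mp)

text \<open>By \<open>range\<close> the average of \<open>L f\<close> vanishes; measurability of
  \<open>h\<close> carries this over to another representative.\<close>

lemma L_maps_mean_zero:
  assumes "L_maps f h" "h \<in> borel_measurable \<mu>"
  shows "vmean \<mu> M h = 0"
proof -
  have "f \<in> D" and eq: "AE v in \<mu>. L f v = h v"
    using assms by (auto simp: L_maps_def)
  then have "L f \<in> L2 \<mu> M" "vmean \<mu> M (L f) = 0"
    using L_in_L2 range by auto
  then show ?thesis
    using vmean_cong_AE[OF eq] L2_measurable assms(2) by metis
qed

text \<open>The kernel is spanned by \<open>M\<close>, and \<open>c * M v\<close> has average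
  \<open>c\<close>.\<close>

lemma L_kernel_mean_free:
  assumes "L_maps f (\<lambda>v. 0)" "vmean \<mu> M f = 0"
  shows "AE v in \<mu>. f v = 0"
proof -
  have f: "f \<in> D" using assms(1) by (simp add: L_maps_def)
  then obtain c where c: "AE v in \<mu>. f v = c * M v"
    using null_space[of f] assms(1) domain by (auto simp: L_maps_def)
  have "vmean \<mu> M f = vmean \<mu> M (\<lambda>v. c * M v)"
    by (rule vmean_cong_AE[OF c]) (use domain_measurable[OF f] in auto)
  also have "\<dots> = c"
    using vmean_lincomb[OF rapid_integrable[OF rapid_M] rapid_integrable[OF rapid_M], of c 0] M_mean
    by simp
  finally show ?thesis using c assms(2) by simp
qed

section \<open>The pseudo-inverse: existence and uniqueness\<close>

lemma pseudo_inverse_spec: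
  assumes "L_maps u h" "vmean \<mu> M u = 0"
  shows "L_maps (pseudo_inverse \<mu> M D L h) h" "vmean \<mu> M (pseudo_inverse \<mu> M D L h) = 0"
proof -
  have "\<exists>u. u \<in> D \<and> vmean \<mu> M u = 0 \<and> (AE v in \<mu>. L u v = h v)"
    using assms by (auto simp: L_maps_def)
  from someI_ex[OF this] show "L_maps (pseudo_inverse \<mu> M D L h) h"
    "vmean \<mu> M (pseudo_inverse \<mu> M D L h) = 0"
    by (auto simp: L_maps_def pseudo_inverse_def)
qed

text \<open>Two solutions with zero average differ by an element of the kernel with zero
  average.\<close>

lemma pseudo_inverse_unique:
  assumes "L_maps u h" "vmean \<mu> M u = 0"
  shows "AE v in \<mu>. u v = pseudo_inverse \<mu> M D L h v"
proof -
  let ?w = "pseudo_inverse \<mu> M D L h"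
  note w = pseudo_inverse_spec[OF assms]
  have int: "integrable \<mu> u" "integrable \<mu> ?w"
    using assms w(1) domain L2_integrable by (auto simp: L_maps_def)
  have "L_maps (\<lambda>v. 1 * u v + (-1) * ?w v) (\<lambda>v. 0)"
    using L_maps_lincomb[OF assms(1) w(1), of 1 "-1"] by simp
  moreover have "vmean \<mu> M (\<lambda>v. 1 * u v + (-1) * ?w v) = 0"
    using vmean_lincomb[OF int, of 1 "-1"] assms w by simp
  ultimately have "AE v in \<mu>. 1 * u v + (-1) * ?w v = 0"
    by (rule L_kernel_mean_free)
  then show ?thesis by simp
qed

lemma pseudo_inverse_exists:
  assumes "mean_free h"
  shows "L_maps (pseudo_inverse \<mu> M D L h) h" "vmean \<mu> M (pseudo_inverse \<mu> M D L h) = 0"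
proof -
  have "h \<in> L2 \<mu> M" "vmean \<mu> M h = 0"
    using assms rapid_L2 by (auto simp: mean_free_def)
  then obtain f where f: "L_maps f h"
    using range by (auto simp: L_maps_def)
  \<comment> \<open>An arbitrary preimage is normalised by removing its average times
    \<open>M\<close>, a correction that \<open>L\<close> annihilates.\<close>
  let ?u = "\<lambda>v. 1 * f v + (- vmean \<mu> M f) * M v"
  have "integrable \<mu> f"
    using f domain L2_integrable by (auto simp: L_maps_def)
  from vmean_lincomb[OF this rapid_integrable[OF rapid_M], of 1 "- vmean \<mu> M f"]
  have "vmean \<mu> M ?u = 0" using M_mean by simp
  moreover have "L_maps ?u h"
    using L_maps_lincomb[OF f L_maps_M, of 1 "- vmean \<mu> M f"] by simp
  ultimately show "L_maps (pseudo_inverse \<mu> M D L h) h" "vmean \<mu> M (pseudo_inverse \<mu> M D L h) = 0"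
    using pseudo_inverse_spec by blast+
qed

section \<open>Functions with zero velocity average and the correctors\<close>

lemma mean_free_lincomb:
  assumes "mean_free f" "mean_free h" shows "mean_free (\<lambda>v. c1 * f v + c2 * h v)"
  using assms vmean_lincomb[of f h c1 c2] rapid_lincomb[of f h c1 c2]
  by (auto simp: mean_free_def rapid_integrable)

lemma mean_free_cmult: "mean_free f \<Longrightarrow> mean_free (\<lambda>v. c * f v)"
  using mean_free_lincomb[of f f c 0] by simp

lemma mean_free_add: "mean_free f \<Longrightarrow> mean_free h \<Longrightarrow> mean_free (\<lambda>v. f v + h v)"
  using mean_free_lincomb[of f h 1 1] by simp

lemma mean_free_diff: "mean_free f \<Longrightarrow> mean_free h \<Longrightarrow> mean_free (\<lambda>v. f v - h v)"
  using mean_free_lincomb[of f h 1 "-1"] by simp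

lemma mean_free_vM: "mean_free (\<lambda>v. v $ i * M v)"
  by (simp add: mean_free_def rapid_vmult rapid_M vM_component_mean)

lemma mean_free_sum:
  assumes "finite S" "\<And>k. k \<in> S \<Longrightarrow> mean_free (f k)"
  shows "mean_free (\<lambda>v. \<Sum>k\<in>S. f k v)"
  using assms
proof (induction S)
  case empty
  \<comment> \<open>The zero function is written as 0 times a coordinate of vM; the coordinate is
    arbitrary, hence \<open>undefined\<close>.\<close>
  show ?case using mean_free_cmult[OF mean_free_vM, of 0 undefined] by simp
qed (simp add: mean_free_add)

text \<open>\<open>M\<close> has average 1, so subtracting this multiple of it removes exactly the
  average of \<open>f\<close>.\<close>

lemma mean_free_projection:
  assumes "rapid \<mu> M f"
  shows "mean_free (\<lambda>v. f v - vmean \<mu> M f * M v)"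
proof -
  let ?c = "- vmean \<mu> M f"
  have "mean_free (\<lambda>v. 1 * f v + ?c * M v)"
    unfolding mean_free_def
    by (subst vmean_lincomb)
      (use M_mean rapid_lincomb[OF assms rapid_M, of 1 ?c] in
        \<open>auto intro: rapid_integrable assms rapid_M\<close>)
  then show ?thesis by simp
qed

text \<open>\<open>inverse_stable\<close> speaks of functions of x and v. It is applied to a
  function constant in x, and the smooth solution it yields, evaluated at x = 0, agrees with the
  corrector up to a null set.\<close>

lemma rapid_corrector:
  assumes "inverse_stable per \<mu> M D L"
  shows "rapid \<mu> M (pseudo_inverse \<mu> M D L (\<lambda>w. w $ i * M w))"
proof -
  let ?h = "\<lambda>w. w $ i * M w"
  have one: "smooth_macro per (\<lambda>x. 1)"
  proof -
    have "iter_partial \<alpha> (\<lambda>x. 1) = (\<lambda>x. if \<alpha> = [] then 1 else 0)" for \<alpha> :: "'d list"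
    proof (induction \<alpha>)
      case (Cons j \<alpha>)
      have "partial j (\<lambda>x. c) = (\<lambda>x. 0)" for c
        by (rule ext, subst partial_eqI[OF has_derivative_const]) simp
      with Cons show ?case by simp
    qed simp
    then show ?thesis by (simp add: smooth_macro_def periodic_def)
  qed
  have "smooth_kinetic per \<mu> M (\<lambda>x. ?h)"
    using smooth_kinetic_tensor[OF one rapid_vmult[OF rapid_M, of i]] by simp
  then obtain u where u: "smooth_kinetic per \<mu> M u"
    "\<And>x. AE v in \<mu>. u x v = pseudo_inverse \<mu> M D L ?h v"
    using assms vM_component_mean unfolding inverse_stable_def by blast
  have "AE v in \<mu>. pseudo_inverse \<mu> M D L ?h v = u 0 v"
    using u(2)[of 0] by eventually_elim simp
  moreover have "pseudo_inverse \<mu> M D L ?h \<in> borel_measurable \<mu>"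
    using pseudo_inverse_exists(1)[OF mean_free_vM] domain_measurable by (simp add: L_maps_def)
  ultimately show ?thesis
    using rapid_cong_AE smooth_kinetic_rapid[OF u(1)] by blast
qed

lemma mean_free_corrector:
  assumes "inverse_stable per \<mu> M D L"
  shows "mean_free (pseudo_inverse \<mu> M D L (\<lambda>w. w $ i * M w))"
  by (simp add: mean_free_def rapid_corrector[OF assms] pseudo_inverse_exists(2)[OF mean_free_vM])

section \<open>The transport term and its projection\<close>

lemma bigo_kinetic_transport:
  assumes "bigo_kinetic per \<mu> M p f"
  shows "bigo_kinetic per \<mu> M p (\<lambda>\<epsilon> x v. v \<bullet> grad (\<lambda>y. f \<epsilon> y v) x)"
  unfolding inner_grad
  by (intro bigo_kinetic_sum bigo_kinetic_vmult bigo_kinetic_partial assms finite)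

lemma bigo_kinetic_projection:
  assumes "mean_stable per \<mu> M" "bigo_kinetic per \<mu> M p f"
  shows "bigo_kinetic per \<mu> M p (\<lambda>\<epsilon> x v. f \<epsilon> x v - vmean \<mu> M (f \<epsilon> x) * M v)"
proof -
  have "bigo_macro per p (\<lambda>\<epsilon> x. vmean \<mu> M (f \<epsilon> x))"
    using assms unfolding mean_stable_def by blast
  from bigo_kinetic_diff[OF assms(2) bigo_kinetic_tensor[OF this rapid_M]] show ?thesis
    by (simp add: mult.commute)
qed

end

section \<open>The limit of the scheme\<close>

theorem theorem2:
  fixes per A :: "real^'d::finite"
    and V :: "(real^'d) set"
    and \<mu> :: "(real^'d) measure"
    and M :: "real^'d \<Rightarrow> real"
    and D :: "(real^'d \<Rightarrow> real) set"
    and L :: "(real^'d \<Rightarrow> real) \<Rightarrow> real^'d \<Rightarrow> real"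
    and s :: nat
    and a_ex a :: "nat \<Rightarrow> nat \<Rightarrow> real"
    and dt \<epsilon>0 :: real
    and \<rho>n :: "real \<Rightarrow> real^'d \<Rightarrow> real"
    and gn :: "real \<Rightarrow> real^'d \<Rightarrow> real^'d \<Rightarrow> real"
    and \<rho> :: "real \<Rightarrow> nat \<Rightarrow> real^'d \<Rightarrow> real"
    and g :: "real \<Rightarrow> nat \<Rightarrow> real^'d \<Rightarrow> real^'d \<Rightarrow> real"
  assumes setting: "kinetic_setting per V \<mu> M D L"
    and tableau: "type_A_tableau s a_ex a"
    and dt: "dt > 0"
    and mean_stable: "mean_stable per \<mu> M"
    and inverse_stable: "inverse_stable per \<mu> M D L"
    and resolvent_stable: "\<And>j. j \<in> {1..s} \<Longrightarrow> resolvent_stable per \<mu> M D L (a j j * dt)"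
    and \<epsilon>0: "\<epsilon>0 > 0"
    and A: "\<And>\<epsilon>. \<epsilon> \<in> {0<..<\<epsilon>0} \<Longrightarrow> norm (\<epsilon> *\<^sub>R A) < 1"
    and \<rho>n: "bigo_macro per 0 \<rho>n"
    and gn: "bigo_kinetic per \<mu> M 0 gn"
    and gn_mean: "\<And>\<epsilon> x. \<epsilon> \<in> {0<..<\<epsilon>0} \<Longrightarrow> vmean \<mu> M (gn \<epsilon> x) = 0"
    and \<rho>: "\<And>j. j \<in> {1..s} \<Longrightarrow> bigo_macro per 0 (\<lambda>\<epsilon>. \<rho> \<epsilon> j)"
    and g_smooth: "\<And>\<epsilon> j. \<epsilon> \<in> {0<..<\<epsilon>0} \<Longrightarrow> j \<in> {1..s} \<Longrightarrow> smooth_kinetic per \<mu> M (g \<epsilon> j)"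
    and g_domain: "\<And>\<epsilon> j x. \<epsilon> \<in> {0<..<\<epsilon>0} \<Longrightarrow> j \<in> {1..s} \<Longrightarrow> g \<epsilon> j x \<in> D"
    and \<rho>_stage: "\<And>\<epsilon> j x. \<epsilon> \<in> {0<..<\<epsilon>0} \<Longrightarrow> j \<in> {1..s} \<Longrightarrow>
      \<rho> \<epsilon> j x = \<rho>n \<epsilon> x
        - (\<Sum>k=1..j. a j k * (dt / \<epsilon>) * divergence (\<lambda>y. vmean \<mu> M (\<lambda>v. g \<epsilon> k y v *\<^sub>R v)) x)"
    and g_stage: "\<And>\<epsilon> j x. \<epsilon> \<in> {0<..<\<epsilon>0} \<Longrightarrow> j \<in> {1..s} \<Longrightarrow>
      AE v in \<mu>. g \<epsilon> j x v = gn \<epsilon> x v - dt / \<epsilon> *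
        ((\<Sum>k=1..<j. a_ex j k *
            (v \<bullet> grad (\<lambda>y. g \<epsilon> k y v) x - vmean \<mu> M (\<lambda>w. w \<bullet> grad (\<lambda>y. g \<epsilon> k y w) x) * M v))
         + (\<Sum>k=1..j. a j k * (M v * (v \<bullet> grad (\<rho> \<epsilon> k) x)))
         - (\<Sum>k=1..j. a j k / \<epsilon> * L (g \<epsilon> k x) v)
         - (\<Sum>k=1..<j. a_ex j k * (M v * (v \<bullet> A) * \<rho> \<epsilon> k x)))"
  shows "\<forall>j\<in>{1..s}. bigo_macro per 1 (\<lambda>\<epsilon> x. \<rho> \<epsilon> j x -
      (\<rho>n \<epsilon> x
        - dt * (\<Sum>k=1..j. a j k *
            divergence (\<lambda>y. diffusion_matrix \<mu> M D L *v grad (\<rho> \<epsilon> k) y) x)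
        + dt * (\<Sum>k=1..<j. a_ex j k *
            divergence (\<lambda>y. diffusion_matrix \<mu> M D L *v (\<rho> \<epsilon> k y *\<^sub>R A)) x)))"
proof -
  interpret kinetic_setting per V \<mu> M D L by (rule setting)
  \<comment> \<open>The correctors \<open>\<Phi> i\<close> solve \<open>L u = v $ i * M v\<close>
    and enter the diffusion matrix as the averages of \<open>v $ i * \<Phi> l v\<close>.
    \<open>P k\<close> is the projected transport of stage k and \<open>Q j\<close> the explicit sum
    of these; \<open>B j\<close> is the source vM \<bullet> W, written coordinatewise so that x and
    v separate.\<close>
  define \<Phi> where "\<Phi> i = pseudo_inverse \<mu> M D L (\<lambda>w. w $ i * M w)" for i
  define W where "W j i \<epsilon> x = (\<Sum>k=1..j. a j k * partial i (\<rho> \<epsilon> k) x)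
    - (\<Sum>k=1..<j. a_ex j k * (A $ i * \<rho> \<epsilon> k x))" for j i \<epsilon> x
  define P where "P k \<epsilon> x v = v \<bullet> grad (\<lambda>y. g \<epsilon> k y v) x
    - vmean \<mu> M (\<lambda>w. w \<bullet> grad (\<lambda>y. g \<epsilon> k y w) x) * M v" for k \<epsilon> x v
  define Q where "Q j \<epsilon> x v = (\<Sum>k=1..<j. a_ex j k * P k \<epsilon> x v)" for j \<epsilon> x v
  define B where "B j \<epsilon> x v = (\<Sum>i\<in>UNIV. (v $ i * M v) * W j i \<epsilon> x)" for j \<epsilon> x v
  note small = eventually_interval[OF \<epsilon>0]

  \<comment> \<open>Orders and averages of the terms of a kinetic stage\<close>
  have W: "bigo_macro per 0 (W j i)" if "j \<in> {1..s}" for i j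
  proof -
    have "bigo_macro per 0 (\<lambda>\<epsilon> x. (\<Sum>k=1..j. a j k * partial i (\<rho> \<epsilon> k) x))"
      using that by (intro bigo_macro_sum bigo_macro_cmult bigo_macro_partial \<rho>) auto
    moreover have "bigo_macro per 0 (\<lambda>\<epsilon> x. (\<Sum>k=1..<j. a_ex j k * (A $ i * \<rho> \<epsilon> k x)))"
      using that by (intro bigo_macro_sum bigo_macro_cmult \<rho>) auto
    ultimately show ?thesis
      using bigo_macro_lincomb[of per 0 _ _ 1 "-1"] by (fastforce simp: W_def[abs_def])
  qed
  have B: "bigo_kinetic per \<mu> M 0 (B j)" if "j \<in> {1..s}" for j
    unfolding B_def[abs_def]
    by (intro bigo_kinetic_sum bigo_kinetic_tensor W that finite rapid_vmult rapid_M)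
  have B_mean_free: "mean_free (B j \<epsilon> x)" for j \<epsilon> x
    using mean_free_sum[OF finite, of UNIV "\<lambda>i v. W j i \<epsilon> x * (v $ i * M v)"]
      mean_free_cmult[OF mean_free_vM]
    by (simp add: B_def[abs_def] mult.commute)
  have P_mean_free: "mean_free (P k \<epsilon> x)" if "\<epsilon> \<in> {0<..<\<epsilon>0}" "k \<in> {1..s}" for k \<epsilon> x
  proof -
    have r: "rapid \<mu> M (\<lambda>v. v $ i * partial i (\<lambda>y. g \<epsilon> k y v) x)" for i
      by (intro rapid_vmult smooth_kinetic_rapid[OF smooth_kinetic_partial] g_smooth that)
    have "rapid \<mu> M (\<lambda>v. \<Sum>i\<in>S. v $ i * partial i (\<lambda>y. g \<epsilon> k y v) x)" if "finite S" for S
      using that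
    proof (induction S)
      case empty
      then show ?case using rapid_lincomb[OF rapid_M rapid_M, of 0 0] by simp
    next
      case (insert i S)
      then show ?case
        using rapid_lincomb[of "\<lambda>v. v $ i * partial i (\<lambda>y. g \<epsilon> k y v) x" _ 1 1] r by simp
    qed
    then have "rapid \<mu> M (\<lambda>v. v \<bullet> grad (\<lambda>y. g \<epsilon> k y v) x)"
      by (simp add: inner_grad)
    then show ?thesis
      unfolding P_def[abs_def] by (rule mean_free_projection)
  qed
  have Q_mean_free: "mean_free (Q j \<epsilon> x)" if "\<epsilon> \<in> {0<..<\<epsilon>0}" "j \<in> {1..s}" for j \<epsilon> x
    unfolding Q_def[abs_def]
    by (intro mean_free_sum mean_free_cmult P_mean_free) (use that in auto)
  \<comment> \<open>The order \<open>p\<close> is left open: 0 suffices in the induction over the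
    stages, while the final remainder takes 1, so that the prefactor \<epsilon> makes it second
    order.\<close>
  have Q: "bigo_kinetic per \<mu> M p (Q j)"
    if "\<And>k. k \<in> {1..<j} \<Longrightarrow> bigo_kinetic per \<mu> M p (\<lambda>\<epsilon>. g \<epsilon> k)" for p j
    unfolding Q_def[abs_def] P_def[abs_def]
    by (intro bigo_kinetic_sum bigo_kinetic_cmult bigo_kinetic_projection[OF mean_stable]
        bigo_kinetic_transport that finite_atLeastLessThan)

  \<comment> \<open>The stage equation solved for the collision terms\<close>
  have stage: "AE v in \<mu>. dt * (\<Sum>k=1..j. a j k * L (g \<epsilon> k x) v) =
      \<epsilon>^2 * g \<epsilon> j x v - \<epsilon>^2 * gn \<epsilon> x v + dt * (\<epsilon> * (Q j \<epsilon> x v + B j \<epsilon> x v))"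
    if \<epsilon>: "\<epsilon> \<in> {0<..<\<epsilon>0}" and j: "j \<in> {1..s}" for \<epsilon> j x
    using g_stage[OF \<epsilon> j, of x]
  proof eventually_elim
    case (elim v)
    \<comment> \<open>The implicit gradients and the explicit drift differ only in their
      coefficients. Exchanging the sums over stages and coordinates collects both in
      \<open>W\<close>.\<close>
    have eB: "(\<Sum>k=1..j. a j k * (M v * (v \<bullet> grad (\<rho> \<epsilon> k) x)))
        - (\<Sum>k=1..<j. a_ex j k * (M v * (v \<bullet> A) * \<rho> \<epsilon> k x)) = B j \<epsilon> x v"
    proof -
      have "(\<Sum>k=1..j. a j k * (M v * (v \<bullet> grad (\<rho> \<epsilon> k) x)))
          = (\<Sum>i\<in>UNIV. (v $ i * M v) * (\<Sum>k=1..j. a j k * partial i (\<rho> \<epsilon> k) x))"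
        by (simp add: inner_grad sum_distrib_left sum.swap[of _ UNIV] mult_ac)
      moreover have "(\<Sum>k=1..<j. a_ex j k * (M v * (v \<bullet> A) * \<rho> \<epsilon> k x))
          = (\<Sum>i\<in>UNIV. (v $ i * M v) * (\<Sum>k=1..<j. a_ex j k * (A $ i * \<rho> \<epsilon> k x)))"
        by (simp add: inner_vec_def sum_distrib_left sum_distrib_right sum.swap[of _ UNIV] mult_ac)
      ultimately show ?thesis
        by (simp add: B_def W_def right_diff_distrib sum_subtractf)
    qed
    have eL: "(\<Sum>k=1..j. a j k / \<epsilon> * L (g \<epsilon> k x) v) = (\<Sum>k=1..j. a j k * L (g \<epsilon> k x) v) / \<epsilon>"
      by (simp add: sum_divide_distrib)
    have "g \<epsilon> j x v = gn \<epsilon> x v - dt / \<epsilon> * (Q j \<epsilon> x v + B j \<epsilon> x v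
        - (\<Sum>k=1..j. a j k * L (g \<epsilon> k x) v) / \<epsilon>)"
      using elim unfolding eL eB[symmetric] by (simp add: Q_def P_def algebra_simps)
    then show ?case
      using \<epsilon> by (simp add: field_simps power2_eq_square)
  qed

  text \<open>The collision terms of the earlier stages occur on the
    right-hand side of the resolvent equation for the stage \<open>j\<close>, so a smooth representative of
    \<open>L g\<close> is carried along.\<close>
  have claim: "bigo_kinetic per \<mu> M 1 (\<lambda>\<epsilon>. g \<epsilon> j) \<and>
      (\<exists>R. bigo_kinetic per \<mu> M 1 R \<and> (\<forall>\<^sub>F \<epsilon> in at_right 0. \<forall>x. L_maps (g \<epsilon> j x) (R \<epsilon> x))) \<and>
      (\<forall>\<^sub>F \<epsilon> in at_right 0. \<forall>x. mean_free (g \<epsilon> j x))" if "j \<in> {1..s}" for j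
    using that
  proof (induction j rule: less_induct)
    case (less j)
    note j = less.prems
    have IH: "bigo_kinetic per \<mu> M 1 (\<lambda>\<epsilon>. g \<epsilon> k)"
      "\<exists>R. bigo_kinetic per \<mu> M 1 R \<and> (\<forall>\<^sub>F \<epsilon> in at_right 0. \<forall>x. L_maps (g \<epsilon> k x) (R \<epsilon> x))"
      if "k \<in> {1..<j}" for k
      using less.IH[of k] that j by auto
    \<comment> \<open>The induction hypothesis gives a representative of \<open>L g\<close> for each
      earlier stage; they are now fixed simultaneously, to be used inside one sum.\<close>
    from bchoice[OF ballI[OF IH(2)]] obtain R where
      "\<forall>k\<in>{1..<j}. bigo_kinetic per \<mu> M 1 (R k) \<and>
        (\<forall>\<^sub>F \<epsilon> in at_right 0. \<forall>x. L_maps (g \<epsilon> k x) (R k \<epsilon> x))" ..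
    then have R: "bigo_kinetic per \<mu> M 1 (R k)"
      "\<forall>\<^sub>F \<epsilon> in at_right 0. \<forall>x. L_maps (g \<epsilon> k x) (R k \<epsilon> x)" if "k \<in> {1..<j}" for k
      using that by simp_all
    \<comment> \<open>The coefficient of \<open>L\<close> in the resolvent. Being nonzero, it also
      allows solving the stage equation for \<open>L\<close> of the current stage.\<close>
    define c where "c = a j j * dt"
    have c: "c \<noteq> 0"
      using type_A_diagonal_nonzero[OF tableau j] dt by (simp add: c_def)
    \<comment> \<open>The right-hand side of \<open>\<epsilon>^2 * g - c * L g = f\<close> for stage
      j. The power \<open>\<epsilon>^1\<close> is written out to match
      \<open>bigo_kinetic_eps\<close>.\<close>
    define f where "f \<epsilon> x v = (\<epsilon>^2 * gn \<epsilon> x v - dt * (\<epsilon>^1 * (Q j \<epsilon> x v + B j \<epsilon> x v)))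
      + dt * (\<Sum>k=1..<j. a j k * R k \<epsilon> x v)" for \<epsilon> x v
    have f: "bigo_kinetic per \<mu> M 1 f"
    proof -
      have "bigo_kinetic per \<mu> M 1 (\<lambda>\<epsilon> x v. \<epsilon>^2 * gn \<epsilon> x v)"
        using bigo_kinetic_eps[OF gn, of 2] by (intro bigo_kinetic_weaken[of _ _ _ 1]) (simp add: numeral_2_eq_2)
      moreover have "bigo_kinetic per \<mu> M 0 (Q j)"
        using IH(1) by (intro Q bigo_kinetic_weaken[of _ _ _ 0]) simp
      from bigo_kinetic_eps[OF bigo_kinetic_add[OF this B[OF j]], of 1]
      have "bigo_kinetic per \<mu> M 1 (\<lambda>\<epsilon> x v. \<epsilon>^1 * (Q j \<epsilon> x v + B j \<epsilon> x v))" by simp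
      moreover have "bigo_kinetic per \<mu> M 1 (\<lambda>\<epsilon> x v. (\<Sum>k=1..<j. a j k * R k \<epsilon> x v))"
        by (intro bigo_kinetic_sum bigo_kinetic_cmult R(1) finite_atLeastLessThan)
      ultimately show ?thesis
        unfolding f_def[abs_def]
        by (intro bigo_kinetic_add bigo_kinetic_diff bigo_kinetic_cmult)
    qed
    \<comment> \<open>The resolvent equation solved for \<open>L g\<close>; unlike
      \<open>L g\<close> itself, this expression is visibly smooth in x.\<close>
    define Rj where "Rj \<epsilon> x v = (1 / c) * (\<epsilon>^2 * g \<epsilon> j x v - f \<epsilon> x v)" for \<epsilon> x v
    have R_ev: "\<forall>\<^sub>F \<epsilon> in at_right 0. \<forall>k\<in>{1..<j}. smooth_kinetic per \<mu> M (R k \<epsilon>) \<and>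
        (\<forall>x. L_maps (g \<epsilon> k x) (R k \<epsilon> x))"
      using R bigo_kineticD[OF R(1)]
      by (intro eventually_ball_finite ballI eventually_conj) auto
    \<comment> \<open>Zero average of the stage is derived here. \<open>Rj\<close> has it as a
      representative of a value of \<open>L\<close>. The function \<open>f\<close> has it because of
      \<open>gn_mean\<close>, the projection in \<open>Q\<close>, the odd moments of
      \<open>M\<close> in \<open>B\<close> and the range of \<open>L\<close> for the earlier
      \<open>R k\<close>.\<close>
    have key: "\<forall>\<^sub>F \<epsilon> in at_right 0. \<forall>x. L_maps (g \<epsilon> j x) (Rj \<epsilon> x) \<and>
        mean_free (g \<epsilon> j x) \<and> mean_free (f \<epsilon> x)"
      using small bigo_kineticD[OF f] bigo_kineticD[OF gn] R_ev
    proof eventually_elim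
      case (elim \<epsilon>)
      show ?case
      proof
        fix x
        have "AE v in \<mu>. \<forall>k\<in>{1..<j}. L (g \<epsilon> k x) v = R k \<epsilon> x v"
          using elim(4) by (intro AE_finite_allI) (auto simp: L_maps_def)
        with stage[OF elim(1) j, of x] have "AE v in \<mu>. L (g \<epsilon> j x) v = Rj \<epsilon> x v"
        proof eventually_elim
          case (elim v)
          have "(\<Sum>k=1..j. a j k * L (g \<epsilon> k x) v)
              = (\<Sum>k=1..<j. a j k * R k \<epsilon> x v) + a j j * L (g \<epsilon> j x) v"
            using j elim(2) by (simp add: sum.last_plus atLeastLessThan_def)
          with elim(1) have "c * L (g \<epsilon> j x) v = \<epsilon>^2 * g \<epsilon> j x v - f \<epsilon> x v"
            by (simp add: c_def f_def algebra_simps)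
          then show ?case
            using c by (simp add: Rj_def field_simps)
        qed
        then have Lg: "L_maps (g \<epsilon> j x) (Rj \<epsilon> x)"
          using g_domain[OF elim(1) j] by (simp add: L_maps_def)
        have R_free: "mean_free (R k \<epsilon> x)" if "k \<in> {1..<j}" for k
        proof -
          have "rapid \<mu> M (R k \<epsilon> x)" "L_maps (g \<epsilon> k x) (R k \<epsilon> x)"
            using elim(4) that smooth_kinetic_rapid by blast+
          then show ?thesis
            using L_maps_mean_zero rapid_measurable by (simp add: mean_free_def)
        qed
        have f_free: "mean_free (f \<epsilon> x)"
          unfolding f_def[abs_def]
          using elim(3) smooth_kinetic_rapid gn_mean[OF elim(1)]
          by (intro mean_free_add mean_free_diff mean_free_cmult mean_free_sum R_free
              B_mean_free Q_mean_free[OF elim(1) j]) (auto simp: mean_free_def)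
        have "rapid \<mu> M (\<lambda>v. (\<epsilon>^2 / c) * g \<epsilon> j x v + (- 1 / c) * f \<epsilon> x v)"
          using g_smooth[OF elim(1) j] elim(2) smooth_kinetic_rapid by (intro rapid_lincomb) blast+
        then have "rapid \<mu> M (Rj \<epsilon> x)"
          by (simp add: Rj_def[abs_def] right_diff_distrib)
        then have "mean_free (Rj \<epsilon> x)"
          using L_maps_mean_zero[OF Lg] rapid_measurable by (simp add: mean_free_def)
        \<comment> \<open>These coefficients invert the definition of \<open>Rj\<close>: the stage
          is \<open>(c * Rj + f) / \<epsilon>^2\<close>.\<close>
        from mean_free_lincomb[OF this f_free, of "c / \<epsilon>^2" "1 / \<epsilon>^2"]
        have "mean_free (g \<epsilon> j x)"
          using c elim(1) by (simp add: Rj_def field_simps)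
        with Lg f_free show "L_maps (g \<epsilon> j x) (Rj \<epsilon> x) \<and> mean_free (g \<epsilon> j x) \<and> mean_free (f \<epsilon> x)"
          by blast
      qed
    qed
    have "\<forall>\<^sub>F \<epsilon> in at_right 0. smooth_kinetic per \<mu> M (g \<epsilon> j) \<and>
        (\<forall>x. vmean \<mu> M (f \<epsilon> x) = 0 \<and> vmean \<mu> M (g \<epsilon> j x) = 0 \<and> g \<epsilon> j x \<in> D \<and>
          (AE v in \<mu>. \<epsilon>\<^sup>2 * g \<epsilon> j x v - c * L (g \<epsilon> j x) v = f \<epsilon> x v))"
      using small key
    proof eventually_elim
      case (elim \<epsilon>)
      have "AE v in \<mu>. \<epsilon>\<^sup>2 * g \<epsilon> j x v - c * L (g \<epsilon> j x) v = f \<epsilon> x v" for x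
      proof -
        have "AE v in \<mu>. L (g \<epsilon> j x) v = Rj \<epsilon> x v"
          using elim(2) by (simp add: L_maps_def)
        then show ?thesis
          by eventually_elim (use c in \<open>simp add: Rj_def\<close>)
      qed
      with elim g_smooth[OF elim(1) j] show ?case
        by (simp add: L_maps_def mean_free_def)
    qed
    then have g: "bigo_kinetic per \<mu> M 1 (\<lambda>\<epsilon>. g \<epsilon> j)"
      by (rule resolvent_stableD[OF resolvent_stable[OF j, folded c_def] f])
    \<comment> \<open>The product is of third order and is weakened twice; the order of
      \<open>Rj\<close> is dictated by \<open>f\<close>.\<close>
    have "bigo_kinetic per \<mu> M 1 (\<lambda>\<epsilon> x v. \<epsilon>^2 * g \<epsilon> j x v)"
      using bigo_kinetic_eps[OF g, of 2]
      by (intro bigo_kinetic_weaken[of _ _ _ 1] bigo_kinetic_weaken[of _ _ _ "Suc 1"])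
        (simp add: numeral_2_eq_2 numeral_3_eq_3)
    then have "bigo_kinetic per \<mu> M 1 Rj"
      unfolding Rj_def[abs_def] by (intro bigo_kinetic_cmult bigo_kinetic_diff f)
    moreover have "\<forall>\<^sub>F \<epsilon> in at_right 0. \<forall>x. L_maps (g \<epsilon> j x) (Rj \<epsilon> x)"
      "\<forall>\<^sub>F \<epsilon> in at_right 0. \<forall>x. mean_free (g \<epsilon> j x)"
      using key by (auto elim: eventually_mono)
    ultimately show ?case
      using g by blast
  qed

  \<comment> \<open>The macroscopic stages in the limit\<close>
  show ?thesis
  proof
    fix j assume j: "j \<in> {1..s}"
    \<comment> \<open>The combination of stages in the macroscopic stage minus its leading term,
      which is the solution of \<open>L w = \<epsilon> * B j\<close> built from the
      correctors.\<close>
    define u where "u \<epsilon> x v = (\<Sum>k=1..j. a j k * g \<epsilon> k x v)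
      - \<epsilon>^1 * (\<Sum>i\<in>UNIV. \<Phi> i v * W j i \<epsilon> x)" for \<epsilon> x v
    \<comment> \<open>What remains of the stage equation after dividing by \<open>dt\<close> and
      cancelling the source \<open>\<epsilon> * B j\<close>; thus \<open>L u = E\<close> almost
      everywhere.\<close>
    define E where "E \<epsilon> x v = (1 / dt) * (\<epsilon>^2 * (g \<epsilon> j x v - gn \<epsilon> x v)) + \<epsilon>^1 * Q j \<epsilon> x v" for \<epsilon> x v
    have gk: "bigo_kinetic per \<mu> M 1 (\<lambda>\<epsilon>. g \<epsilon> k)" if "k \<in> {1..j}" for k
      using claim[of k] that j by auto
    have \<Phi>: "rapid \<mu> M (\<Phi> i)" "mean_free (\<Phi> i)" "L_maps (\<Phi> i) (\<lambda>w. w $ i * M w)" for i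
      unfolding \<Phi>_def using rapid_corrector mean_free_corrector inverse_stable
        pseudo_inverse_exists(1)[OF mean_free_vM] by auto
    have E: "bigo_kinetic per \<mu> M 2 E"
    proof -
      have "bigo_kinetic per \<mu> M 0 (\<lambda>\<epsilon> x v. g \<epsilon> j x v - gn \<epsilon> x v)"
        using gk[of j] j by (intro bigo_kinetic_diff gn bigo_kinetic_weaken[of _ _ _ 0]) simp
      from bigo_kinetic_eps[OF this, of 2]
      have "bigo_kinetic per \<mu> M 2 (\<lambda>\<epsilon> x v. \<epsilon>^2 * (g \<epsilon> j x v - gn \<epsilon> x v))" by simp
      moreover have "bigo_kinetic per \<mu> M 1 (Q j)"
        by (intro Q gk) simp
      from bigo_kinetic_eps[OF this, of 1]
      have "bigo_kinetic per \<mu> M 2 (\<lambda>\<epsilon> x v. \<epsilon>^1 * Q j \<epsilon> x v)" by (simp only: one_add_one)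
      ultimately show ?thesis
        unfolding E_def[abs_def] by (intro bigo_kinetic_add bigo_kinetic_cmult)
    qed
    \<comment> \<open>This crude order serves to obtain smoothness of \<open>u\<close>, which
      \<open>inverse_stable\<close> presupposes; the second order comes from
      \<open>E\<close>.\<close>
    have "bigo_kinetic per \<mu> M 1 u"
    proof -
      have "bigo_kinetic per \<mu> M 0 (\<lambda>\<epsilon> x v. \<Sum>i\<in>UNIV. \<Phi> i v * W j i \<epsilon> x)"
        by (intro bigo_kinetic_sum bigo_kinetic_tensor W j \<Phi> finite)
      from bigo_kinetic_eps[OF this, of 1]
      have "bigo_kinetic per \<mu> M 1 (\<lambda>\<epsilon> x v. \<epsilon>^1 * (\<Sum>i\<in>UNIV. \<Phi> i v * W j i \<epsilon> x))" by simp
      then show ?thesis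
        unfolding u_def[abs_def]
        by (intro bigo_kinetic_diff bigo_kinetic_sum bigo_kinetic_cmult gk finite_atLeastAtMost)
    qed
    note u_smooth = bigo_kineticD[OF this]
    have mf: "\<forall>\<^sub>F \<epsilon> in at_right 0. \<forall>k\<in>{1..j}. \<forall>x. mean_free (g \<epsilon> k x)"
      using claim j by (intro eventually_ball_finite ballI) auto
    have "\<forall>\<^sub>F \<epsilon> in at_right 0. smooth_kinetic per \<mu> M (u \<epsilon>) \<and> (\<forall>x. vmean \<mu> M (E \<epsilon> x) = 0 \<and>
        (AE v in \<mu>. u \<epsilon> x v = pseudo_inverse \<mu> M D L (E \<epsilon> x) v))"
      using small u_smooth mf bigo_kineticD[OF E]
    proof eventually_elim
      case (elim \<epsilon>)
      have "vmean \<mu> M (E \<epsilon> x) = 0 \<and> (AE v in \<mu>. u \<epsilon> x v = pseudo_inverse \<mu> M D L (E \<epsilon> x) v)" for x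
      proof -
        have "L_maps (\<lambda>v. 1 * (\<Sum>k=1..j. a j k * g \<epsilon> k x v)
              + (- \<epsilon>) * (\<Sum>i\<in>UNIV. W j i \<epsilon> x * \<Phi> i v))
            (\<lambda>v. 1 * (\<Sum>k=1..j. a j k * L (g \<epsilon> k x) v)
              + (- \<epsilon>) * (\<Sum>i\<in>UNIV. W j i \<epsilon> x * (v $ i * M v)))"
          by (intro L_maps_lincomb L_maps_sum \<Phi> finite finite_atLeastAtMost)
            (use g_domain[OF elim(1)] j in \<open>auto simp: L_maps_def\<close>)
        moreover have "AE v in \<mu>. 1 * (\<Sum>k=1..j. a j k * L (g \<epsilon> k x) v)
              + (- \<epsilon>) * (\<Sum>i\<in>UNIV. W j i \<epsilon> x * (v $ i * M v)) = E \<epsilon> x v"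
          using stage[OF elim(1) j, of x]
        proof eventually_elim
          case (elim v)
          have "(\<Sum>i\<in>UNIV. W j i \<epsilon> x * (v $ i * M v)) = B j \<epsilon> x v"
            by (simp add: B_def mult.commute)
          with elim dt show ?case
            by (simp add: E_def field_simps)
        qed
        ultimately have Lu: "L_maps (u \<epsilon> x) (E \<epsilon> x)"
          using L_maps_cong_AE by (fastforce simp: u_def[abs_def] mult.commute)
        have "mean_free (\<lambda>v. (\<Sum>k=1..j. a j k * g \<epsilon> k x v) - \<epsilon>^1 * (\<Sum>i\<in>UNIV. W j i \<epsilon> x * \<Phi> i v))"
          by (intro mean_free_diff mean_free_cmult mean_free_sum \<Phi> finite finite_atLeastAtMost)
            (use elim in auto)
        then have "vmean \<mu> M (u \<epsilon> x) = 0"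
          by (simp add: u_def[abs_def] mean_free_def mult.commute)
        with Lu pseudo_inverse_unique L_maps_mean_zero rapid_measurable[OF smooth_kinetic_rapid[OF elim(4)]]
        show ?thesis by blast
      qed
      with elim show ?case by blast
    qed
    then have u: "bigo_kinetic per \<mu> M 2 u"
      by (rule inverse_stableD[OF inverse_stable E])

    \<comment> \<open>The divergence of the average of v times \<open>u\<close>. For small
      \<epsilon> the error of the limit relation is exactly
      \<open>- dt * (Z \<epsilon> x / \<epsilon>)\<close>, so second order of \<open>Z\<close>
      leaves first order.\<close>
    define Z where "Z \<epsilon> x = (\<Sum>i\<in>UNIV. partial i (\<lambda>y. vmean \<mu> M (\<lambda>v. v $ i * u \<epsilon> y v)) x)" for \<epsilon> x
    have "bigo_macro per 2 (\<lambda>\<epsilon> y. vmean \<mu> M (\<lambda>v. v $ i * u \<epsilon> y v))" for i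
      using mean_stable bigo_kinetic_vmult[OF u, of i] unfolding mean_stable_def by blast
    then have "bigo_macro per (Suc 1) Z"
      unfolding Z_def[abs_def]
      by (intro bigo_macro_sum bigo_macro_partial finite) (simp add: numeral_2_eq_2)
    then have Z: "bigo_macro per 1 (\<lambda>\<epsilon> x. (- dt) * (Z \<epsilon> x / \<epsilon>))"
      by (intro bigo_macro_cmult bigo_macro_div)

    let ?K = "diffusion_matrix \<mu> M D L"
    have K: "?K $ i $ l = vmean \<mu> M (\<lambda>v. v $ i * \<Phi> l v)" for i l
      by (simp add: diffusion_matrix_def \<Phi>_def)
    have \<rho>_ev: "\<forall>\<^sub>F \<epsilon> in at_right 0. \<forall>k\<in>{1..j}. smooth_macro per (\<rho> \<epsilon> k)"
      using j by (intro eventually_ball_finite ballI bigo_macroD[OF \<rho>]) auto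
    show "bigo_macro per 1 (\<lambda>\<epsilon> x. \<rho> \<epsilon> j x -
      (\<rho>n \<epsilon> x
        - dt * (\<Sum>k=1..j. a j k * divergence (\<lambda>y. ?K *v grad (\<rho> \<epsilon> k) y) x)
        + dt * (\<Sum>k=1..<j. a_ex j k * divergence (\<lambda>y. ?K *v (\<rho> \<epsilon> k y *\<^sub>R A)) x)))"
    proof (rule bigo_macro_cong[OF _ Z])
      show "\<forall>\<^sub>F \<epsilon> in at_right 0. (\<lambda>x. (- dt) * (Z \<epsilon> x / \<epsilon>)) = (\<lambda>x. \<rho> \<epsilon> j x -
        (\<rho>n \<epsilon> x
          - dt * (\<Sum>k=1..j. a j k * divergence (\<lambda>y. ?K *v grad (\<rho> \<epsilon> k) y) x)
          + dt * (\<Sum>k=1..<j. a_ex j k * divergence (\<lambda>y. ?K *v (\<rho> \<epsilon> k y *\<^sub>R A)) x)))"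
        using small \<rho>_ev
      proof eventually_elim
        case (elim \<epsilon>)
        note \<rho>_smooth = elim(2)[rule_format]
        note \<rho>_diff = smooth_macroD(2)[OF \<rho>_smooth]
          smooth_macroD(2)[OF smooth_macro_partial[OF \<rho>_smooth]]
        have g_smooth': "smooth_kinetic per \<mu> M (g \<epsilon> k)" if "k \<in> {1..j}" for k
          using g_smooth[OF elim(1), of k] that j by simp
        define G where "G k i y = vmean \<mu> M (\<lambda>v. v $ i * g \<epsilon> k y v)" for k i y
        have G: "smooth_macro per (G k i)" if "k \<in> {1..j}" for k i
          using mean_stable smooth_kinetic_vmult[OF g_smooth'[OF that]]
          unfolding mean_stable_def G_def[abs_def] by blast
        have divG: "divergence (\<lambda>y. vmean \<mu> M (\<lambda>v. g \<epsilon> k y v *\<^sub>R v)) x = (\<Sum>i\<in>UNIV. partial i (G k i) x)"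
          if "k \<in> {1..j}" for k x
          using vmean_velocity[OF smooth_kinetic_rapid[OF g_smooth'[OF that]]]
          by (simp add: divergence_def G_def[abs_def])
        have div\<rho>: "divergence (\<lambda>y. ?K *v grad (\<rho> \<epsilon> k) y) x
            = (\<Sum>i\<in>UNIV. \<Sum>l\<in>UNIV. ?K $ i $ l * partial i (partial l (\<rho> \<epsilon> k)) x)"
          if "k \<in> {1..j}" for k x
          using partial_sum[OF finite, of UNIV "\<lambda>l. partial l (\<rho> \<epsilon> k)" x]
            \<rho>_diff(2)[OF that]
          by (simp add: divergence_def matrix_vector_mult_def grad_def)
        have divA: "divergence (\<lambda>y. ?K *v (\<rho> \<epsilon> k y *\<^sub>R A)) x
            = (\<Sum>i\<in>UNIV. \<Sum>l\<in>UNIV. ?K $ i $ l * (A $ l * partial i (\<rho> \<epsilon> k) x))"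
          if "k \<in> {1..<j}" for k x
        proof -
          have "partial i (\<lambda>y. \<Sum>l\<in>UNIV. (?K $ i $ l * A $ l) * \<rho> \<epsilon> k y) x
              = (\<Sum>l\<in>UNIV. (?K $ i $ l * A $ l) * partial i (\<rho> \<epsilon> k) x)" for i
            using that by (intro partial_sum \<rho>_diff finite) simp
          then show ?thesis
            by (simp add: divergence_def matrix_vector_mult_def mult_ac)
        qed
        have W_smooth: "W j l \<epsilon> differentiable (at x)" for l x
          unfolding W_def[abs_def] by (auto intro!: derivative_intros \<rho>_diff)
        have dW: "partial i (W j l \<epsilon>) x = (\<Sum>k=1..j. a j k * partial i (partial l (\<rho> \<epsilon> k)) x)
            - (\<Sum>k=1..<j. a_ex j k * (A $ l * partial i (\<rho> \<epsilon> k) x))" for i l x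
        proof -
          have d1: "(\<lambda>y. \<Sum>k=1..j. a j k * partial l (\<rho> \<epsilon> k) y) differentiable (at x)"
            and d2: "(\<lambda>y. \<Sum>k=1..<j. (a_ex j k * A $ l) * \<rho> \<epsilon> k y) differentiable (at x)"
            by (auto intro!: derivative_intros \<rho>_diff)
          have "partial i (W j l \<epsilon>) x = partial i (\<lambda>y. \<Sum>k=1..j. a j k * partial l (\<rho> \<epsilon> k) y) x
              - partial i (\<lambda>y. \<Sum>k=1..<j. (a_ex j k * A $ l) * \<rho> \<epsilon> k y) x"
            using partial_lincomb[OF d1 d2, of i 1 "-1"] by (simp add: W_def[abs_def] mult.assoc)
          also have "partial i (\<lambda>y. \<Sum>k=1..j. a j k * partial l (\<rho> \<epsilon> k) y) x
              = (\<Sum>k=1..j. a j k * partial i (partial l (\<rho> \<epsilon> k)) x)"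
            by (intro partial_sum \<rho>_diff finite_atLeastAtMost)
          also have "partial i (\<lambda>y. \<Sum>k=1..<j. (a_ex j k * A $ l) * \<rho> \<epsilon> k y) x
              = (\<Sum>k=1..<j. (a_ex j k * A $ l) * partial i (\<rho> \<epsilon> k) x)"
            by (intro partial_sum \<rho>_diff finite_atLeastLessThan) simp
          finally show ?thesis by (simp add: mult.assoc)
        qed
        \<comment> \<open>The first sum is the flux of the scheme, the second the flux of the limit.
          The coefficients 1 and \<open>- \<epsilon>\<close> are spelled out to match
          \<open>vmean_lincomb\<close> and \<open>partial_lincomb\<close>.\<close>
        have vu: "vmean \<mu> M (\<lambda>v. v $ i * u \<epsilon> y v)
            = 1 * (\<Sum>k=1..j. a j k * G k i y) + (- \<epsilon>) * (\<Sum>l\<in>UNIV. ?K $ i $ l * W j l \<epsilon> y)" for i y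
        proof -
          have ig: "integrable \<mu> (\<lambda>v. v $ i * g \<epsilon> k y v)" if "k \<in> {1..j}" for k
            by (intro rapid_integrable rapid_vmult smooth_kinetic_rapid[OF g_smooth'] that)
          have i\<Phi>: "integrable \<mu> (\<lambda>v. v $ i * \<Phi> l v)" for l
            by (intro rapid_integrable rapid_vmult \<Phi>)
          have eq: "(\<lambda>v. v $ i * u \<epsilon> y v) = (\<lambda>v. 1 * (\<Sum>k=1..j. a j k * (v $ i * g \<epsilon> k y v))
              + (- \<epsilon>) * (\<Sum>l\<in>UNIV. W j l \<epsilon> y * (v $ i * \<Phi> l v)))"
          proof
            fix v
            have e1: "v $ i * (\<Sum>k=1..j. a j k * g \<epsilon> k y v) = (\<Sum>k=1..j. a j k * (v $ i * g \<epsilon> k y v))"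
              by (simp add: sum_distrib_left mult.left_commute)
            have e2: "v $ i * (\<Sum>l\<in>UNIV. \<Phi> l v * W j l \<epsilon> y) = (\<Sum>l\<in>UNIV. W j l \<epsilon> y * (v $ i * \<Phi> l v))"
              by (simp add: sum_distrib_left mult_ac)
            have "v $ i * u \<epsilon> y v = v $ i * (\<Sum>k=1..j. a j k * g \<epsilon> k y v)
              - \<epsilon> * (v $ i * (\<Sum>l\<in>UNIV. \<Phi> l v * W j l \<epsilon> y))"
              by (simp add: u_def right_diff_distrib)
            then show "v $ i * u \<epsilon> y v = 1 * (\<Sum>k=1..j. a j k * (v $ i * g \<epsilon> k y v))
              + (- \<epsilon>) * (\<Sum>l\<in>UNIV. W j l \<epsilon> y * (v $ i * \<Phi> l v))"
              unfolding e1 e2 by simp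
          qed
          have s1: "vmean \<mu> M (\<lambda>v. \<Sum>k=1..j. a j k * (v $ i * g \<epsilon> k y v)) = (\<Sum>k=1..j. a j k * G k i y)"
            unfolding G_def by (rule vmean_sum) (rule ig)
          have "vmean \<mu> M (\<lambda>v. \<Sum>l\<in>UNIV. W j l \<epsilon> y * (v $ i * \<Phi> l v))
              = (\<Sum>l\<in>UNIV. W j l \<epsilon> y * vmean \<mu> M (\<lambda>v. v $ i * \<Phi> l v))"
            by (rule vmean_sum) (rule i\<Phi>)
          then have s2: "vmean \<mu> M (\<lambda>v. \<Sum>l\<in>UNIV. W j l \<epsilon> y * (v $ i * \<Phi> l v))
              = (\<Sum>l\<in>UNIV. ?K $ i $ l * W j l \<epsilon> y)"
            by (simp only: K mult.commute)
          show ?thesis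
            unfolding eq s1[symmetric] s2[symmetric]
            by (rule vmean_lincomb; intro Bochner_Integration.integrable_sum integrable_mult_right ig i\<Phi>)
        qed
        have dvu: "partial i (\<lambda>y. vmean \<mu> M (\<lambda>v. v $ i * u \<epsilon> y v)) x
            = (\<Sum>k=1..j. a j k * partial i (G k i) x) - \<epsilon> * (\<Sum>l\<in>UNIV. ?K $ i $ l * partial i (W j l \<epsilon>) x)"
          for i x
        proof -
          have d1: "(\<lambda>y. \<Sum>k=1..j. a j k * G k i y) differentiable (at x)"
            and d2: "(\<lambda>y. \<Sum>l\<in>UNIV. ?K $ i $ l * W j l \<epsilon> y) differentiable (at x)"
            by (auto intro!: derivative_intros smooth_macroD(2)[OF G] W_smooth)
          have p1: "partial i (\<lambda>y. \<Sum>k=1..j. a j k * G k i y) x = (\<Sum>k=1..j. a j k * partial i (G k i) x)"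
            by (intro partial_sum smooth_macroD(2)[OF G] finite_atLeastAtMost)
          have p2: "partial i (\<lambda>y. \<Sum>l\<in>UNIV. ?K $ i $ l * W j l \<epsilon> y) x
              = (\<Sum>l\<in>UNIV. ?K $ i $ l * partial i (W j l \<epsilon>) x)"
            by (intro partial_sum W_smooth finite)
          show ?thesis
            unfolding vu partial_lincomb[OF d1 d2] p1 p2 by simp
        qed
        show ?case
        proof
          fix x
          let ?S1 = "\<Sum>k=1..j. a j k * divergence (\<lambda>y. ?K *v grad (\<rho> \<epsilon> k) y) x"
          let ?S2 = "\<Sum>k=1..<j. a_ex j k * divergence (\<lambda>y. ?K *v (\<rho> \<epsilon> k y *\<^sub>R A)) x"
          let ?S0 = "\<Sum>k=1..j. a j k * divergence (\<lambda>y. vmean \<mu> M (\<lambda>v. g \<epsilon> k y v *\<^sub>R v)) x"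
          have S0: "?S0 = (\<Sum>i\<in>UNIV. \<Sum>k=1..j. a j k * partial i (G k i) x)"
            by (simp add: divG sum_distrib_left sum.swap[of _ UNIV])
          have S1: "?S1 = (\<Sum>i\<in>UNIV. \<Sum>l\<in>UNIV. ?K $ i $ l *
              (\<Sum>k=1..j. a j k * partial i (partial l (\<rho> \<epsilon> k)) x))"
            \<comment> \<open>Both index sets are fixed so that a coordinate sum is exchanged with
              the stage sum and not with the other coordinate sum; \<open>Suc 0\<close> is the form
              that 1 takes under simplification.\<close>
            by (simp add: div\<rho> sum_distrib_left sum.swap[of _ UNIV "{Suc 0..j}"] mult_ac)
          have S2: "?S2 = (\<Sum>i\<in>UNIV. \<Sum>l\<in>UNIV. ?K $ i $ l *
              (\<Sum>k=1..<j. a_ex j k * (A $ l * partial i (\<rho> \<epsilon> k) x)))"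
            by (simp add: divA sum_distrib_left sum.swap[of _ UNIV "{Suc 0..<j}"] mult_ac)
          \<comment> \<open>Stated for arbitrary \<open>p\<close>, \<open>c\<close>,
            \<open>t\<close> and \<open>r\<close>, so that the stage sums stay closed while the
            coordinate sums are split.\<close>
          have split_sums: "(\<Sum>i\<in>UNIV. p i - \<epsilon> * (\<Sum>l\<in>UNIV. c i l * (t i l - r i l)))
              = (\<Sum>i\<in>UNIV. p i) - \<epsilon> * ((\<Sum>i\<in>UNIV. \<Sum>l\<in>UNIV. c i l * t i l)
                - (\<Sum>i\<in>UNIV. \<Sum>l\<in>UNIV. c i l * r i l))"
            for p :: "'d \<Rightarrow> real" and c t r :: "'d \<Rightarrow> 'd \<Rightarrow> real"
            by (simp add: right_diff_distrib sum_subtractf sum_distrib_left)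
          have Z_eq: "Z \<epsilon> x = ?S0 - \<epsilon> * (?S1 - ?S2)"
            unfolding Z_def dvu dW S0 S1 S2 by (rule split_sums)
          have \<rho>_eq: "\<rho> \<epsilon> j x = \<rho>n \<epsilon> x - dt / \<epsilon> * ?S0"
            using \<rho>_stage[OF elim(1) j, of x] by (simp add: sum_distrib_left mult_ac)
          show "(- dt) * (Z \<epsilon> x / \<epsilon>) = \<rho> \<epsilon> j x - (\<rho>n \<epsilon> x - dt * ?S1 + dt * ?S2)"
            unfolding Z_eq \<rho>_eq using elim(1) by (simp add: field_simps)
        qed
      qed
    qed
  qed
qed

end
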